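(* There are exactly three projective equivalence classes of smooth binary quartic forms $f\in\mathbb{C}[x,y]$ (homogeneous of degree $4$) such that the Macaulay polynomial $\mathrm{Mac}(f)$ and the Hessian polynomial $\mathrm{Hess}(f)$ are projectively equivalent. They correspond to the values $0$, $1728$ and $6912$ of the $j$-invariant $j(f)$.
   Context: A binary quartic form $f\in\mathbb{C}[x,y]$ is smooth (nonsingular) if it is a product of four linear forms that are pairwise non-proportional, i.e. $V(f)\subset\mathbb{P}^1$ consists of four distinct points. Projective equivalence: two nonzero homogeneous polynomials $p,q$ of the same degree in $\mathbb{C}[x,y]$ are projectively equivalent if one is obtained from the other by an invertible linear change of variables, up to a nonzero scalar, i.e. $q(\overline{x})=c\,p(B\overline{x})$ for some $B\in GL_2(\mathbb{C})$ and $c\in\mathbb{C}\setminus\{0\}$. Hessian polynomial: $\mathrm{Hess}(f)$ is the determinant of the $2\times 2$ matrix of second-order partial derivatives of $f$, considered up to nonzero scalar multiplication. Macaulay polynomial: let the polynomial ring act on itself by differentiation, $p\cdot g:=p\left(\frac{\partial}{\partial x},\frac{\partial}{\partial y}\right)(g)$, and for $g\neq 0$ let $g^{\perp}:=\{p\in\mathbb{C}[x,y] : p\cdot g=0\}$. Let $J(f)=\left(\frac{\partial f}{\partial x},\frac{\partial f}{\partial y}\right)$ be the Jacobian ideal of $f$. For $f$ smooth of degree $4$, $\mathbb{C}[x,y]/J(f)$ is a graded Artinian Gorenstein local ring of socle degree $4$, and by a theorem of Macaulay there is a homogeneous polynomial $g$ of degree $4$, unique up to nonzero scalar, with $J(f)=g^{\perp}$.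 This $g$ is denoted $\mathrm{Mac}(f)$. $j$-invariant: if $\lambda$ is the cross-ratio of the four distinct points of $V(f)\subset\mathbb{P}^1$ (in some order), then $j(f):=2^8\frac{(\lambda^2-\lambda+1)^3}{\lambda^2(\lambda-1)^2}$; this does not depend on the order of the points, and the values of $j$ correspond bijectively to the projective equivalence classes of smooth binary quartic forms. *)

theory Defs
  imports "HOL-Analysis.Analysis" "HOL-Computational_Algebra.Computational_Algebra"
begin

text \<open>
  The ring C[x,y] is \<open>complex poly poly\<close>, read as C[x][y]: the coefficient of
  \<open>x^i y^j\<close> in \<open>p\<close> is \<open>coeff (coeff p j) i\<close>, and the constant \<open>c\<close> is \<open>[:[:c:]:]\<close>,
  so that multiplication by \<open>c\<close> is \<open>smult [:c:]\<close>.
\<close>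

type_synonym bpoly = "complex poly poly"

definition var_x :: bpoly where "var_x = [:[:0, 1:]:]"
definition var_y :: bpoly where "var_y = [:0, 1:]"

definition deriv_x :: "bpoly \<Rightarrow> bpoly" where "deriv_x p = map_poly pderiv p"
definition deriv_y :: "bpoly \<Rightarrow> bpoly" where "deriv_y p = pderiv p"

definition homogeneous :: "nat \<Rightarrow> bpoly \<Rightarrow> bool" where
  "homogeneous d p \<longleftrightarrow> (\<forall>i j. coeff (coeff p j) i \<noteq> 0 \<longrightarrow> i + j = d)"

text \<open>\<open>bsubst p u v\<close> is \<open>p(u, v)\<close>, with \<open>u\<close>, \<open>v\<close> again in C[x,y].\<close>

definition bsubst :: "bpoly \<Rightarrow> bpoly \<Rightarrow> bpoly \<Rightarrow> bpoly" where
  "bsubst p u v =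
     (\<Sum>j\<le>degree p. \<Sum>i\<le>degree (coeff p j). smult [:coeff (coeff p j) i:] (u ^ i * v ^ j))"

definition linear_form :: "complex ^ 2 \<Rightarrow> bpoly" where
  "linear_form a = smult [:a $ 1:] var_x + smult [:a $ 2:] var_y"

text \<open>The row \<open>B $ k\<close> gives the \<open>k\<close>-th entry of \<open>B (x, y)\<^sup>T\<close>.\<close>

definition change_vars :: "complex ^ 2 ^ 2 \<Rightarrow> bpoly \<Rightarrow> bpoly" where
  "change_vars B p = bsubst p (linear_form (B $ 1)) (linear_form (B $ 2))"

definition proj_equiv :: "bpoly \<Rightarrow> bpoly \<Rightarrow> bool" where
  "proj_equiv p q \<longleftrightarrow>
     p \<noteq> 0 \<and> q \<noteq> 0 \<and> (\<exists>d. homogeneous d p \<and> homogeneous d q) \<and>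
     (\<exists>B c. invertible B \<and> c \<noteq> 0 \<and> q = smult [:c:] (change_vars B p))"

text \<open>
  Taking \<open>c = 0\<close> in the non-proportionality conditions here and in \<open>j_invariant\<close> below
  shows that the linear forms (the vectors representing points) are nonzero.
\<close>

definition smooth_quartic :: "bpoly \<Rightarrow> bool" where
  "smooth_quartic f \<longleftrightarrow>
     (\<exists>l :: nat \<Rightarrow> bpoly. f = (\<Prod>k<4. l k) \<and> (\<forall>k<4. homogeneous 1 (l k)) \<and>
        (\<forall>k<4. \<forall>m<4. k \<noteq> m \<longrightarrow> (\<forall>c. l k \<noteq> smult [:c:] (l m))))"

definition hess :: "bpoly \<Rightarrow> bpoly" where
  "hess f = det (vector [vector [deriv_x (deriv_x f), deriv_x (deriv_y f)],
                         vector [deriv_y (deriv_x f), deriv_y (deriv_y f)]] :: bpoly ^ 2 ^ 2)"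

definition diff_action :: "bpoly \<Rightarrow> bpoly \<Rightarrow> bpoly" where
  "diff_action p g =
     (\<Sum>j\<le>degree p. \<Sum>i\<le>degree (coeff p j).
        smult [:coeff (coeff p j) i:] ((deriv_x ^^ i) ((deriv_y ^^ j) g)))"

definition annihilator :: "bpoly \<Rightarrow> bpoly set" where
  "annihilator g = {p. diff_action p g = 0}"

definition jacobian_ideal :: "bpoly \<Rightarrow> bpoly set" where
  "jacobian_ideal f = {a * deriv_x f + b * deriv_y f | a b. True}"

text \<open>
  For smooth \<open>f\<close> the polynomial \<open>mac f\<close> is determined up to a nonzero scalar only;
  \<open>SOME\<close> picks a representative, and \<open>proj_equiv\<close> does not depend on which one.
\<close>

definition mac :: "bpoly \<Rightarrow> bpoly" where
  "mac f = (SOME g. g \<noteq> 0 \<and> homogeneous 4 g \<and> jacobian_ideal f = annihilator g)"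

text \<open>The affine cone over \<open>V(f)\<close>: points of the projective line are nonzero vectors up to scaling.\<close>

definition zero_cone :: "bpoly \<Rightarrow> (complex ^ 2) set" where
  "zero_cone f = {v. v \<noteq> 0 \<and> poly (poly f [:v $ 2:]) (v $ 1) = 0}"

definition bracket :: "complex ^ 2 \<Rightarrow> complex ^ 2 \<Rightarrow> complex" where
  "bracket v w = v $ 1 * w $ 2 - v $ 2 * w $ 1"

text \<open>
  In the affine chart \<open>z = v $ 1 / v $ 2\<close> this is
  \<open>((z1 - z3) * (z2 - z4)) / ((z1 - z4) * (z2 - z3))\<close>.
\<close>

definition cross_ratio ::
  "complex ^ 2 \<Rightarrow> complex ^ 2 \<Rightarrow> complex ^ 2 \<Rightarrow> complex ^ 2 \<Rightarrow> complex" where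
  "cross_ratio v1 v2 v3 v4 =
     (bracket v1 v3 * bracket v2 v4) / (bracket v1 v4 * bracket v2 v3)"

definition j_of_cross_ratio :: "complex \<Rightarrow> complex" where
  "j_of_cross_ratio t = 2 ^ 8 * (t\<^sup>2 - t + 1) ^ 3 / (t\<^sup>2 * (t - 1)\<^sup>2)"

text \<open>
  Only meant for smooth \<open>f\<close>: then the points \<open>v 0, \<dots>, v 3\<close> are all of \<open>V(f)\<close> in some
  order, and the value depends neither on the order nor on the representing vectors.
\<close>

definition j_invariant :: "bpoly \<Rightarrow> complex" where
  "j_invariant f = (THE z. \<exists>v :: nat \<Rightarrow> complex ^ 2.
     (\<forall>k<4. v k \<in> zero_cone f) \<and>
     (\<forall>k<4. \<forall>m<4. k \<noteq> m \<longrightarrow> (\<forall>c. v k \<noteq> c *s v m)) \<and>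
     z = j_of_cross_ratio (cross_ratio (v 0) (v 1) (v 2) (v 3)))"

definition smooth_quartic_classes :: "bpoly set set" where
  "smooth_quartic_classes =
     {f. smooth_quartic f} // {(p, q). smooth_quartic p \<and> smooth_quartic q \<and> proj_equiv p q}"

definition mac_hess_classes :: "bpoly set set" where
  "mac_hess_classes = {C \<in> smooth_quartic_classes. \<exists>f\<in>C. proj_equiv (mac f) (hess f)}"

end

theory Submission
  imports Defs
begin

text \<open>
  Every smooth binary quartic is projectively equivalent to a biquadratic form
  \<open>N(m) = x^4 + 6 m x^2 y^2 + y^4\<close> with \<open>9 m^2 \<noteq> 1\<close>: writing two of its linear factors as
  \<open>p\<close> and \<open>q\<close>, suitably scaled, it becomes a multiple of \<open>p q (p^2 + 2 s p q + q^2)\<close>, which is even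
  in \<open>p + q\<close> and in \<open>p - q\<close> (\<open>smooth_quartic_normal_form\<close>). The roots of \<open>N(m)\<close> in the affine
  chart are \<open>a\<close>, \<open>- a\<close>, \<open>1 / a\<close>, \<open>- 1 / a\<close> for some \<open>a\<close>, and their cross-ratio yields
  \<open>j = 1728 (1 + 3 m^2)^3 / (1 - 9 m^2)^2\<close> (\<open>j_invariant_biquadratic\<close>).

  The substitutions \<open>x \<mapsto> \<i> x\<close> and \<open>(x, y) \<mapsto> (x - y, x + y)\<close> change \<open>m\<close> into \<open>- m\<close> and
  \<open>(1 - m) / (1 + 3 m)\<close>. For fixed \<open>m\<close>, the equation \<open>j(n) = j(m)\<close> has degree six in \<open>n\<close>, and its
  roots are exactly the parameters that these two substitutions reach. Hence \<open>j\<close> classifies smooth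
  quartics (\<open>proj_equiv_iff_j_invariant\<close>).

  The Hessian is covariant, and the Macaulay polynomial is contravariant, that is, it is transformed
  by the inverse transpose. So both may be computed for \<open>N(m)\<close>, where, up to scalars, they are
  \<open>m (x^4 + y^4) - 2 x^2 y^2\<close> and \<open>m (x^4 + y^4) + (1 - 3 m^2) x^2 y^2\<close>. These two are proportional
  when \<open>m (1 - m^2) = 0\<close>, which means \<open>j = 1728\<close>. Otherwise they are multiples of the smooth forms
  \<open>N(- 1 / (3 m))\<close> and \<open>N((1 - 3 m^2) / (6 m))\<close>, whose \<open>j\<close>-invariants agree if and only if
  \<open>(1 + 3 m^2)^3\<close> is \<open>0\<close> or \<open>4 (1 - 9 m^2)^2\<close>, that is, \<open>j = 0\<close> or \<open>j = 6912\<close>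
  (\<open>proj_equiv_biquadratic_mac_hess\<close>). Finally every complex number is a \<open>j\<close>-invariant, so these
  three values belong to three classes.
\<close>

section \<open>Polynomials in two variables\<close>

definition scalar :: "complex \<Rightarrow> bpoly" where "scalar c = [:[:c:]:]"

lemma scalar_add: "scalar (a + b) = scalar a + scalar b"
  and scalar_mult: "scalar (a * b) = scalar a * scalar b"
  and scalar_diff: "scalar (a - b) = scalar a - scalar b"
  and scalar_uminus: "scalar (- a) = - scalar a"
  and scalar_0: "scalar 0 = 0"
  and scalar_1: "scalar 1 = 1"
  by (simp_all add: scalar_def one_pCons)

lemma scalar_numeral: "scalar (numeral n) = numeral n"
  by (simp add: scalar_def numeral_poly)

lemma scalar_power: "scalar (a ^ n) = scalar a ^ n"
  by (induction n) (simp_all add: scalar_mult scalar_1)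

lemma scalar_eq_0_iff [simp]: "scalar c = 0 \<longleftrightarrow> c = 0"
  by (simp add: scalar_def)

lemmas scalar_hom = scalar_add scalar_mult scalar_diff scalar_uminus scalar_0 scalar_1
  scalar_numeral scalar_power

lemma smult_eq_scalar: "smult [:c:] p = scalar c * p"
  by (simp add: scalar_def)

lemma const_pCons: "[:pCons c a:] = scalar c + var_x * [:a:]"
  by (simp add: scalar_def var_x_def)

lemma pCons_eq_var_y: "pCons a p = [:a:] + var_y * p"
  by (simp add: var_y_def)

text \<open>
  Evaluation, substitution, the chain rule and the action by differential operators are all compatible
  with sums and products, so this induction reduces their properties to constants and the two variables.
\<close>

lemma bpoly_induct [case_names scalar var_x var_y add mult]:
  assumes "\<And>c. P (scalar c)" "P var_x" "P var_y"
    and "\<And>p q. P p \<Longrightarrow> P q \<Longrightarrow> P (p + q)" and "\<And>p q. P p \<Longrightarrow> P q \<Longrightarrow> P (p * q)"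
  shows "P p"
proof -
  have c: "P [:a:]" for a
  proof (induction a)
    case 0
    then show ?case using assms(1)[of 0] by (simp add: scalar_0)
  next
    case (pCons c a)
    then show ?case by (simp only: const_pCons assms)
  qed
  show ?thesis
  proof (induction p)
    case 0
    then show ?case using assms(1)[of 0] by (simp add: scalar_0)
  next
    case (pCons a p)
    then show ?case by (simp only: pCons_eq_var_y[of a p] assms c)
  qed
qed

definition value_at :: "bpoly \<Rightarrow> complex ^ 2 \<Rightarrow> complex" where
  "value_at p v = poly (poly p [:v $ 2:]) (v $ 1)"

lemma value_simps [simp]:
  "value_at (p + q) v = value_at p v + value_at q v"
  "value_at (p - q) v = value_at p v - value_at q v"
  "value_at (- p) v = - value_at p v"
  "value_at (p * q) v = value_at p v * value_at q v"
  "value_at (p ^ n) v = value_at p v ^ n"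
  "value_at 0 v = 0" "value_at 1 v = 1" "value_at (numeral k) v = numeral k"
  "value_at (scalar c) v = c" "value_at var_x v = v $ 1" "value_at var_y v = v $ 2"
  by (simp_all add: value_at_def scalar_def var_x_def var_y_def numeral_poly)

text \<open>
  Since the complex numbers are infinite, a polynomial identity may be checked pointwise. This turns
  identities in C[x,y] into identities between complex numbers.
\<close>

lemma bpoly_eqI_value:
  assumes "\<And>v. value_at p v = value_at q v"
  shows "p = q"
proof -
  have "poly (p - q) [:y:] = 0" for y
  proof -
    have "poly (poly (p - q) [:y:]) x = 0" for x
      using assms[of "vector [x, y]"] by (simp add: value_at_def)
    then show ?thesis using poly_all_0_iff_0 by blast
  qed
  then have "range (\<lambda>y. [:y:]) \<subseteq> {z. poly (p - q) z = 0}" by blast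
  moreover have "infinite (range (\<lambda>y::complex. [:y:]))"
    using infinite_UNIV_char_0[where 'a = complex] by (simp add: finite_image_iff inj_on_def)
  ultimately have "infinite {z. poly (p - q) z = 0}" using finite_subset by blast
  then have "p - q = 0" using poly_roots_finite by blast
  then show ?thesis by simp
qed

section \<open>Linear substitutions\<close>

text \<open>
  Both \<open>bsubst\<close> and \<open>diff_action\<close> are sums up to a degree that varies with the polynomial. As the
  summands vanish at zero coefficients, the bound may be raised, and this makes such sums additive
  and gives them a recursion along \<open>pCons\<close>.
\<close>

lemma sum_degree_mono:
  fixes p :: "'a::zero poly"
  assumes "\<And>i. F i 0 = (0::'b::comm_monoid_add)" "degree p \<le> n"
  shows "(\<Sum>i\<le>degree p. F i (coeff p i)) = (\<Sum>i\<le>n. F i (coeff p i))"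
  using assms by (intro sum.mono_neutral_left) (auto simp: coeff_eq_0 not_le)

lemma sum_degree_add:
  fixes p q :: "'a::comm_monoid_add poly"
  assumes "\<And>i. F i 0 = (0::'b::comm_monoid_add)" "\<And>i a b. F i (a + b) = F i a + F i b"
  shows "(\<Sum>i\<le>degree (p + q). F i (coeff (p + q) i)) =
    (\<Sum>i\<le>degree p. F i (coeff p i)) + (\<Sum>i\<le>degree q. F i (coeff q i))"
proof -
  let ?n = "max (degree p) (degree q)"
  have "degree (p + q) \<le> ?n" by (rule degree_add_le_max)
  moreover have "degree p \<le> ?n" "degree q \<le> ?n" by simp_all
  ultimately have "(\<Sum>i\<le>degree (p + q). F i (coeff (p + q) i)) = (\<Sum>i\<le>?n. F i (coeff (p + q) i))"
    "(\<Sum>i\<le>degree p. F i (coeff p i)) = (\<Sum>i\<le>?n. F i (coeff p i))"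
    "(\<Sum>i\<le>degree q. F i (coeff q i)) = (\<Sum>i\<le>?n. F i (coeff q i))"
    by (simp_all only: sum_degree_mono[where F = F, OF assms(1)])
  then show ?thesis by (simp only: coeff_add assms(2) sum.distrib)
qed

lemma sum_degree_pCons:
  assumes "\<And>i. F i 0 = (0::'b::comm_monoid_add)"
  shows "(\<Sum>i\<le>degree (pCons a p). F i (coeff (pCons a p) i)) =
    F 0 a + (\<Sum>i\<le>degree p. F (Suc i) (coeff p i))"
proof -
  have "degree (pCons a p) \<le> Suc (degree p)" by (rule degree_pCons_le)
  then have "(\<Sum>i\<le>degree (pCons a p). F i (coeff (pCons a p) i)) =
      (\<Sum>i\<le>Suc (degree p). F i (coeff (pCons a p) i))"
    by (rule sum_degree_mono[where F = F, OF assms])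
  then show ?thesis
    by (simp only: sum.atMost_Suc_shift coeff_pCons_0 coeff_pCons_Suc)
qed

definition subst_x :: "complex poly \<Rightarrow> bpoly \<Rightarrow> bpoly" where
  "subst_x a u = (\<Sum>i\<le>degree a. scalar (coeff a i) * u ^ i)"

lemma subst_x_add: "subst_x (a + b) u = subst_x a u + subst_x b u"
  unfolding subst_x_def
  by (rule sum_degree_add[where F = "\<lambda>i c. scalar c * u ^ i"]) (simp_all add: scalar_hom ring_distribs)

lemma subst_x_pCons: "subst_x (pCons c a) u = scalar c + u * subst_x a u"
  unfolding subst_x_def
  by (subst sum_degree_pCons[where F = "\<lambda>i c. scalar c * u ^ i"])
     (simp_all add: scalar_hom sum_distrib_left mult_ac)

lemma subst_x_0 [simp]: "subst_x 0 u = 0"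
  by (simp add: subst_x_def scalar_0)

lemma subst_x_smult: "subst_x (smult c a) u = scalar c * subst_x a u"
  by (induction a) (simp_all add: subst_x_pCons scalar_mult algebra_simps)

lemma subst_x_mult: "subst_x (a * b) u = subst_x a u * subst_x b u"
  by (induction a) (simp_all add: subst_x_add subst_x_smult subst_x_pCons scalar_0 algebra_simps)

lemma bsubst_altdef: "bsubst p u v = (\<Sum>j\<le>degree p. subst_x (coeff p j) u * v ^ j)"
  by (simp add: bsubst_def subst_x_def smult_eq_scalar sum_distrib_right mult.assoc del: smult_conv_map_poly)

lemma bsubst_add: "bsubst (p + q) u v = bsubst p u v + bsubst q u v"
  unfolding bsubst_altdef
  by (rule sum_degree_add[where F = "\<lambda>j a. subst_x a u * v ^ j"]) (simp_all add: subst_x_add ring_distribs)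

lemma bsubst_pCons: "bsubst (pCons a p) u v = subst_x a u + v * bsubst p u v"
  unfolding bsubst_altdef
  by (subst sum_degree_pCons[where F = "\<lambda>j a. subst_x a u * v ^ j"])
     (simp_all add: sum_distrib_left mult_ac)

lemma bsubst_0: "bsubst 0 u v = 0"
  by (simp add: bsubst_altdef)

lemma bsubst_smult: "bsubst (smult a p) u v = subst_x a u * bsubst p u v"
  by (induction p) (simp_all add: bsubst_0 bsubst_pCons subst_x_mult algebra_simps)

lemma bsubst_mult: "bsubst (p * q) u v = bsubst p u v * bsubst q u v"
  by (induction p) (simp_all add: bsubst_0 bsubst_add bsubst_smult bsubst_pCons algebra_simps)

lemma bsubst_scalar: "bsubst (scalar c) u v = scalar c"
  by (simp add: scalar_def bsubst_pCons bsubst_0 subst_x_pCons)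

lemma bsubst_var_x: "bsubst var_x u v = u"
  and bsubst_var_y: "bsubst var_y u v = v"
proof -
  have "bsubst [:a:] u v = subst_x a u" for a
    by (simp add: bsubst_pCons bsubst_0)
  moreover have "subst_x [:a, b:] u = scalar a + u * scalar b" "subst_x 1 u = 1" for a b
    by (simp_all add: one_pCons subst_x_pCons) (simp add: scalar_def)
  ultimately show "bsubst var_x u v = u" "bsubst var_y u v = v"
    by (simp_all add: var_x_def var_y_def bsubst_pCons scalar_hom)
qed

lemma linear_form_eq: "linear_form a = scalar (a $ 1) * var_x + scalar (a $ 2) * var_y"
  by (simp add: linear_form_def smult_eq_scalar)

lemma change_vars_hom [simp]:
  "change_vars B (p + q) = change_vars B p + change_vars B q"
  "change_vars B (p * q) = change_vars B p * change_vars B q"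
  "change_vars B (scalar c) = scalar c"
  "change_vars B var_x = scalar (B $ 1 $ 1) * var_x + scalar (B $ 1 $ 2) * var_y"
  "change_vars B var_y = scalar (B $ 2 $ 1) * var_x + scalar (B $ 2 $ 2) * var_y"
  by (simp_all add: change_vars_def bsubst_add bsubst_mult bsubst_scalar bsubst_var_x
      bsubst_var_y linear_form_eq)

lemma change_vars_0 [simp]: "change_vars B 0 = 0"
  and change_vars_1 [simp]: "change_vars B 1 = 1"
  by (simp_all add: change_vars_hom(3)[of B 0, unfolded scalar_0]
       change_vars_hom(3)[of B 1, unfolded scalar_1])

lemma change_vars_minus [simp]: "change_vars B (- p) = - change_vars B p"
  using change_vars_hom(2)[of B "scalar (-1)" p] change_vars_hom(3)[of B "-1"]
  by (simp add: scalar_hom)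

lemma change_vars_diff [simp]: "change_vars B (p - q) = change_vars B p - change_vars B q"
  using change_vars_hom(1)[of B p "-q"] by simp

lemma change_vars_power [simp]: "change_vars B (p ^ n) = change_vars B p ^ n"
  by (induction n) simp_all

lemma value_change_vars [simp]: "value_at (change_vars B p) v = value_at p (B *v v)"
  by (induction p rule: bpoly_induct) (simp_all add: matrix_vector_mult_def sum_2)

lemma change_vars_compose: "change_vars A (change_vars B p) = change_vars (B ** A) p"
  by (rule bpoly_eqI_value) (simp add: matrix_vector_mul_assoc)

lemma change_vars_id [simp]: "change_vars (mat 1) p = p"
  by (rule bpoly_eqI_value) simp

section \<open>Derivatives and the Hessian\<close>

lemma deriv_simps [simp]:
  "deriv_x (p + q) = deriv_x p + deriv_x q"
  "deriv_y (p + q) = deriv_y p + deriv_y q"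
  "deriv_x (p - q) = deriv_x p - deriv_x q"
  "deriv_y (p - q) = deriv_y p - deriv_y q"
  "deriv_x (scalar c) = 0" "deriv_y (scalar c) = 0"
  "deriv_x 0 = 0" "deriv_y 0 = 0" "deriv_x 1 = 0" "deriv_y 1 = 0"
  "deriv_x (numeral k) = 0" "deriv_y (numeral k) = 0"
  "deriv_x var_x = 1" "deriv_y var_x = 0" "deriv_x var_y = 0" "deriv_y var_y = 1"
  by (simp_all add: deriv_x_def deriv_y_def scalar_def var_x_def var_y_def pderiv_add pderiv_diff
     map_poly_pCons pderiv_pCons one_pCons poly_eq_iff coeff_map_poly numeral_poly)

lemma deriv_uminus [simp]: "deriv_x (- p) = - deriv_x p" "deriv_y (- p) = - deriv_y p"
  using deriv_simps(3,4)[of 0 p] by simp_all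

lemma deriv_x_pCons: "deriv_x (pCons a p) = pCons (pderiv a) (deriv_x p)"
  by (simp add: deriv_x_def map_poly_pCons)

lemma deriv_x_smult: "deriv_x (smult a p) = smult a (deriv_x p) + smult (pderiv a) p"
  by (induction p) (simp_all add: deriv_x_pCons pderiv_mult algebra_simps)

lemma deriv_x_mult [simp]: "deriv_x (p * q) = deriv_x p * q + p * deriv_x q"
  by (induction p) (simp_all add: deriv_x_pCons deriv_x_smult algebra_simps)

lemma deriv_y_mult [simp]: "deriv_y (p * q) = deriv_y p * q + p * deriv_y q"
  by (simp add: deriv_y_def pderiv_mult algebra_simps)

lemma deriv_commute: "deriv_x (deriv_y p) = deriv_y (deriv_x p)"
  by (induction p rule: bpoly_induct) (simp_all add: algebra_simps)

lemma deriv_change_vars: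
  "deriv_x (change_vars B p) = scalar (B $ 1 $ 1) * change_vars B (deriv_x p)
     + scalar (B $ 2 $ 1) * change_vars B (deriv_y p)"
  "deriv_y (change_vars B p) = scalar (B $ 1 $ 2) * change_vars B (deriv_x p)
     + scalar (B $ 2 $ 2) * change_vars B (deriv_y p)"
  by (induction p rule: bpoly_induct) (simp_all add: algebra_simps)

lemma hess_eq: "hess f = deriv_x (deriv_x f) * deriv_y (deriv_y f) - deriv_x (deriv_y f) ^ 2"
  by (simp add: hess_def det_2 deriv_commute power2_eq_square)

text \<open>
  By the chain rule the matrix of second derivatives of \<open>f(B(x,y))\<close> is the old one, evaluated at
  \<open>B(x,y)\<close>, between the transpose of \<open>B\<close> and \<open>B\<close>; this contributes the square of the determinant.
\<close>

lemma hess_change_vars: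
  "hess (scalar c * change_vars B f) = scalar ((c * det B)\<^sup>2) * change_vars B (hess f)"
  unfolding hess_eq
  by (simp add: deriv_change_vars deriv_commute det_2 scalar_hom) algebra

section \<open>The action by differential operators\<close>

definition act_x :: "complex poly \<Rightarrow> bpoly \<Rightarrow> bpoly" where
  "act_x a g = (\<Sum>i\<le>degree a. scalar (coeff a i) * (deriv_x ^^ i) g)"

lemma act_x_add: "act_x (a + b) g = act_x a g + act_x b g"
  unfolding act_x_def
  by (rule sum_degree_add[where F = "\<lambda>i c. scalar c * (deriv_x ^^ i) g"])
    (simp_all add: scalar_hom ring_distribs)

lemma act_x_pCons: "act_x (pCons c a) g = scalar c * g + act_x a (deriv_x g)"
  unfolding act_x_def
  by (subst sum_degree_pCons[where F = "\<lambda>i c. scalar c * (deriv_x ^^ i) g"])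
     (simp_all add: scalar_hom funpow_Suc_right del: funpow.simps)

lemma act_x_0 [simp]: "act_x 0 g = 0"
  by (simp add: act_x_def scalar_0)

lemma diff_action_altdef: "diff_action p g = (\<Sum>j\<le>degree p. act_x (coeff p j) ((deriv_y ^^ j) g))"
  by (simp add: diff_action_def act_x_def smult_eq_scalar)

lemma diff_action_add: "diff_action (p + q) g = diff_action p g + diff_action q g"
  unfolding diff_action_altdef
  by (rule sum_degree_add[where F = "\<lambda>j a. act_x a ((deriv_y ^^ j) g)"]) (simp_all add: act_x_add)

lemma diff_action_pCons: "diff_action (pCons a p) g = act_x a g + diff_action p (deriv_y g)"
  unfolding diff_action_altdef
  by (subst sum_degree_pCons[where F = "\<lambda>j a. act_x a ((deriv_y ^^ j) g)"])
     (simp_all add: funpow_Suc_right del: funpow.simps)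

lemma diff_action_0 [simp]: "diff_action 0 g = 0"
  by (simp add: diff_action_altdef)

lemma diff_action_var_x [simp]: "diff_action var_x g = deriv_x g"
  and diff_action_var_y [simp]: "diff_action var_y g = deriv_y g"
  and diff_action_scalar [simp]: "diff_action (scalar c) g = scalar c * g"
proof -
  have one: "act_x 1 g = g" for g
    unfolding one_pCons by (simp add: act_x_pCons scalar_hom del: pCons_one)
  show "diff_action var_x g = deriv_x g" "diff_action var_y g = deriv_y g"
    by (simp_all add: var_x_def var_y_def diff_action_pCons act_x_pCons scalar_hom one
)
  show "diff_action (scalar c) g = scalar c * g"
    unfolding scalar_def[of c] by (simp add: diff_action_pCons act_x_pCons) (simp add: scalar_def)
qed

lemma act_x_deriv_x: "act_x a (deriv_x g) = deriv_x (act_x a g)"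
  by (induction a arbitrary: g) (simp_all add: act_x_pCons)

lemma act_x_deriv_y: "act_x a (deriv_y g) = deriv_y (act_x a g)"
  by (induction a arbitrary: g) (simp_all add: act_x_pCons deriv_commute)

lemma act_x_add_right: "act_x a (g + h) = act_x a g + act_x a h"
  by (induction a arbitrary: g h) (simp_all add: act_x_pCons algebra_simps)

lemma act_x_0_right [simp]: "act_x a 0 = 0"
  by (induction a) (simp_all add: act_x_pCons)

lemma act_x_smult: "act_x (smult c a) g = scalar c * act_x a g"
  by (induction a arbitrary: g) (simp_all add: act_x_pCons scalar_mult algebra_simps)

lemma act_x_mult: "act_x (a * b) g = act_x a (act_x b g)"
  by (induction a arbitrary: g)
    (simp_all add: act_x_add act_x_smult act_x_pCons scalar_0 act_x_deriv_x)

lemma diff_action_deriv_y: "diff_action p (deriv_y g) = deriv_y (diff_action p g)"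
  by (induction p arbitrary: g) (simp_all add: diff_action_pCons act_x_deriv_y)

lemma diff_action_smult: "diff_action (smult a p) g = act_x a (diff_action p g)"
  by (induction p arbitrary: g)
    (simp_all add: diff_action_pCons act_x_mult act_x_add_right)

text \<open>
  The partial derivatives commute with each other, so C[x,y] acts on itself as a commutative ring of
  operators.
\<close>

lemma diff_action_mult: "diff_action (p * q) g = diff_action p (diff_action q g)"
  by (induction p arbitrary: g)
    (simp_all add: diff_action_add diff_action_smult diff_action_pCons diff_action_deriv_y)

lemma diff_action_add_right: "diff_action p (g + h) = diff_action p g + diff_action p h"
  by (induction p arbitrary: g h rule: bpoly_induct)
    (simp_all add: diff_action_mult diff_action_add algebra_simps)

lemma diff_action_scalar_right: "diff_action p (scalar c * g) = scalar c * diff_action p g"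
  by (induction p arbitrary: g rule: bpoly_induct)
    (simp_all add: diff_action_mult diff_action_add distrib_left mult.left_commute)

text \<open>
  Differential operators transform contragrediently: the hypothesis says that \<open>C\<close> is the inverse
  transpose of \<open>B\<close>. It is enough to compare the two sides for operators of first order.
\<close>

lemma diff_action_change_vars:
  assumes "B ** transpose C = mat 1"
  shows "diff_action (change_vars B p) (change_vars C g) = change_vars C (diff_action p g)"
proof -
  have C: "B $ 1 $ 1 * C $ 1 $ 1 + B $ 1 $ 2 * C $ 1 $ 2 = 1"
    "B $ 1 $ 1 * C $ 2 $ 1 + B $ 1 $ 2 * C $ 2 $ 2 = 0"
    "B $ 2 $ 1 * C $ 1 $ 1 + B $ 2 $ 2 * C $ 1 $ 2 = 0"
    "B $ 2 $ 1 * C $ 2 $ 1 + B $ 2 $ 2 * C $ 2 $ 2 = 1"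
    using assms by (simp_all add: vec_eq_iff forall_2 matrix_matrix_mult_def transpose_def mat_def sum_2)
  have E: "scalar a * (scalar b * p + scalar c * q) + scalar d * (scalar e * p + scalar h * q)
      = scalar (a * b + d * e) * p + scalar (a * c + d * h) * q" for a b c d e h p q
    by (simp add: scalar_hom algebra_simps)
  show ?thesis
    by (induction p arbitrary: g rule: bpoly_induct)
      (simp_all add: diff_action_add diff_action_mult deriv_change_vars E C scalar_hom)
qed

lemma diff_action_simps [simp]:
  "diff_action 0 g = 0" "diff_action p 0 = 0" "diff_action 1 g = g" "diff_action (numeral k) g = numeral k * g"
  "diff_action (p + q) g = diff_action p g + diff_action q g"
  "diff_action (p * q) g = diff_action p (diff_action q g)"
  "diff_action p (g + h) = diff_action p g + diff_action p h"
  using diff_action_scalar_right[of p 0 0] diff_action_scalar[of 1 g] diff_action_scalar[of "numeral k" g]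
  by (simp_all add: diff_action_add diff_action_mult diff_action_add_right scalar_hom)

section \<open>Homogeneous polynomials\<close>

lemma homogeneous_0 [simp]: "homogeneous d 0"
  by (simp add: homogeneous_def)

lemma homogeneous_add: "homogeneous d p \<Longrightarrow> homogeneous d q \<Longrightarrow> homogeneous d (p + q)"
  unfolding homogeneous_def by (metis add.left_neutral coeff_add)

lemma homogeneous_sum: "(\<And>i. i \<in> I \<Longrightarrow> homogeneous d (p i)) \<Longrightarrow> homogeneous d (sum p I)"
  by (induction I rule: infinite_finite_induct) (auto intro: homogeneous_add)

lemma homogeneous_mult:
  assumes "homogeneous d p" "homogeneous e q"
  shows "homogeneous (d + e) (p * q)"
  unfolding homogeneous_def
proof (intro allI impI)
  fix k n
  assume "coeff (coeff (p * q) n) k \<noteq> 0"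
  then have "(\<Sum>j\<le>n. \<Sum>i\<le>k. coeff (coeff p j) i * coeff (coeff q (n - j)) (k - i)) \<noteq> 0"
    by (simp add: coeff_mult coeff_sum)
  then obtain j where j: "j \<in> {..n}"
    "(\<Sum>i\<le>k. coeff (coeff p j) i * coeff (coeff q (n - j)) (k - i)) \<noteq> 0"
    by (rule sum.not_neutral_contains_not_neutral)
  from j(2) obtain i where "i \<in> {..k}"
    "coeff (coeff p j) i * coeff (coeff q (n - j)) (k - i) \<noteq> 0"
    by (rule sum.not_neutral_contains_not_neutral)
  with j(1) have "i + j = d" "k - i + (n - j) = e" "i \<le> k" "j \<le> n"
    using assms by (auto simp: homogeneous_def)
  then show "k + n = d + e" by linarith
qed

lemma homogeneous_scalar: "homogeneous 0 (scalar c)"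
  by (auto simp: homogeneous_def scalar_def coeff_pCons split: nat.splits)

lemma homogeneous_var_x: "homogeneous 1 var_x" and homogeneous_var_y: "homogeneous 1 var_y"
  by (auto simp: homogeneous_def var_x_def var_y_def coeff_pCons one_pCons split: nat.splits)

lemma homogeneous_scalar_mult: "homogeneous d p \<Longrightarrow> homogeneous d (scalar c * p)"
  using homogeneous_mult[OF homogeneous_scalar, of d p c] by simp

lemma homogeneous_power: "homogeneous d p \<Longrightarrow> homogeneous (n * d) (p ^ n)"
  by (induction n) (auto intro: homogeneous_mult homogeneous_scalar[of 1, unfolded scalar_1])

lemma homogeneous_linear_form: "homogeneous 1 (linear_form a)"
  unfolding linear_form_eq
  by (intro homogeneous_add homogeneous_scalar_mult homogeneous_var_x homogeneous_var_y)

lemma homogeneous_1_imp_linear_form: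
  assumes "homogeneous 1 l"
  obtains a where "l = linear_form a"
proof
  have "coeff (coeff l j) i = 0" if "i + j \<noteq> 1" for i j
    using assms that unfolding homogeneous_def by blast
  then show "l = linear_form (vector [coeff (coeff l 0) 1, coeff (coeff l 1) 0])"
    by (auto simp: linear_form_def var_x_def var_y_def poly_eq_iff coeff_pCons one_pCons split: nat.splits)
qed

lemma homogeneous_change_vars:
  assumes "homogeneous d p"
  shows "homogeneous d (change_vars B p)"
  unfolding change_vars_def bsubst_def smult_eq_scalar
proof (intro homogeneous_sum)
  fix i j
  let ?c = "coeff (coeff p j) i" and ?u = "linear_form (B $ 1)" and ?v = "linear_form (B $ 2)"
  show "homogeneous d (scalar ?c * (?u ^ i * ?v ^ j))"
  proof (cases "?c = 0")
    case True
    then show ?thesis by (simp add: scalar_0)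
  next
    case False
    then have "d = i * 1 + j * 1" using assms by (simp add: homogeneous_def)
    then show ?thesis
      by (metis homogeneous_scalar_mult homogeneous_mult homogeneous_power homogeneous_linear_form)
  qed
qed

section \<open>Projective equivalence\<close>

lemma change_vars_inverse:
  assumes "invertible B"
  obtains A where "invertible A" "B ** A = mat 1" "A ** B = mat 1"
    "\<And>p. change_vars A (change_vars B p) = p" "\<And>p. change_vars B (change_vars A p) = p"
proof -
  obtain A where "B ** A = mat 1" "A ** B = mat 1" using assms by (auto simp: invertible_def)
  then show thesis using that[of A] by (auto simp: change_vars_compose invertible_def)
qed

lemma change_vars_eq_0_iff: "invertible B \<Longrightarrow> change_vars B p = 0 \<longleftrightarrow> p = 0"
  by (metis change_vars_inverse change_vars_0)

lemma proj_equivI: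
  assumes "p \<noteq> 0" "homogeneous d p" "invertible B" "c \<noteq> 0" "q = scalar c * change_vars B p"
  shows "proj_equiv p q"
  using assms unfolding proj_equiv_def smult_eq_scalar
  by (auto simp: change_vars_eq_0_iff intro: homogeneous_scalar_mult homogeneous_change_vars)

lemma proj_equivE:
  assumes "proj_equiv p q"
  obtains d B c where "p \<noteq> 0" "homogeneous d p" "q \<noteq> 0" "homogeneous d q"
    "invertible B" "c \<noteq> 0" "q = scalar c * change_vars B p"
  using assms unfolding proj_equiv_def smult_eq_scalar by blast

lemma proj_equiv_scalar:
  assumes "p \<noteq> 0" "homogeneous d p" "c \<noteq> 0"
  shows "proj_equiv p (scalar c * p)"
  by (rule proj_equivI[of p d "mat 1" c]) (use assms in \<open>auto simp: invertible_def\<close>)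

lemma proj_equiv_sym:
  assumes "proj_equiv p q"
  shows "proj_equiv q p"
proof -
  obtain d B c where B: "p \<noteq> 0" "homogeneous d p" "q \<noteq> 0" "homogeneous d q"
    "invertible B" "c \<noteq> 0" "q = scalar c * change_vars B p"
    using assms by (rule proj_equivE)
  obtain A where A: "invertible A" "\<And>p. change_vars A (change_vars B p) = p"
    using change_vars_inverse[OF \<open>invertible B\<close>] by metis
  have "p = scalar (1 / c) * change_vars A q"
    using B(6) by (simp add: B(7) A flip: mult.assoc scalar_mult) (simp add: scalar_1)
  then show ?thesis using B A by (intro proj_equivI[of q d A "1 / c"]) auto
qed

lemma proj_equiv_trans:
  assumes "proj_equiv p q" "proj_equiv q r"
  shows "proj_equiv p r"
proof -
  obtain d B c where B: "p \<noteq> 0" "homogeneous d p" "invertible B" "c \<noteq> 0"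
    "q = scalar c * change_vars B p"
    using assms(1) by (rule proj_equivE)
  obtain A e where A: "invertible A" "e \<noteq> 0" "r = scalar e * change_vars A q"
    using assms(2) by (rule proj_equivE)
  have "r = scalar (e * c) * change_vars (B ** A) p"
    by (simp add: A B scalar_mult change_vars_compose mult.assoc)
  then show ?thesis
    using A B by (intro proj_equivI[of p d "B ** A" "e * c"]) (auto intro: invertible_mult)
qed

lemma proj_equiv_congr:
  assumes "proj_equiv p p'" "proj_equiv q q'"
  shows "proj_equiv p' q' \<longleftrightarrow> proj_equiv p q"
  using assms by (metis proj_equiv_sym proj_equiv_trans)

section \<open>Biquadratic normal forms of smooth quartics\<close>

lemma all_less_4: "(\<forall>k<4::nat. P k) \<longleftrightarrow> P 0 \<and> P 1 \<and> P 2 \<and> P 3"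
  by (auto simp: numeral_eq_Suc less_Suc_eq)

lemma prod_less_4: "(\<Prod>k<4::nat. l k) = l 0 * l 1 * l 2 * (l 3 :: 'a::comm_monoid_mult)"
  by (simp add: numeral_eq_Suc mult_ac)

lemma biquadratic_pencil_neq_0: "scalar a * (var_x ^ 4 + var_y ^ 4) + scalar b * (var_x\<^sup>2 * var_y\<^sup>2) \<noteq> 0"
  if "a \<noteq> 0 \<or> b \<noteq> 0"
proof
  assume *: "scalar a * (var_x ^ 4 + var_y ^ 4) + scalar b * (var_x\<^sup>2 * var_y\<^sup>2) = 0"
  have "value_at (scalar a * (var_x ^ 4 + var_y ^ 4) + scalar b * (var_x\<^sup>2 * var_y\<^sup>2)) v = 0" for v
    unfolding * by simp
  from this[of "vector [1, 0]"] this[of "vector [1, 1]"] show False using that by simp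
qed

lemma biquadratic_pencil_homogeneous:
  "homogeneous 4 (scalar a * (var_x ^ 4 + var_y ^ 4) + scalar b * (var_x\<^sup>2 * var_y\<^sup>2))"
proof -
  have "homogeneous (2 * 1 + 2 * 1) (var_x\<^sup>2 * var_y\<^sup>2)"
    by (intro homogeneous_mult homogeneous_power homogeneous_var_x homogeneous_var_y)
  moreover have "homogeneous (4 * 1) (var_x ^ 4)" "homogeneous (4 * 1) (var_y ^ 4)"
    by (intro homogeneous_power homogeneous_var_x homogeneous_var_y)+
  ultimately show ?thesis
    by (auto intro!: homogeneous_add homogeneous_scalar_mult)
qed

definition biquadratic :: "complex \<Rightarrow> bpoly" where
  "biquadratic m = var_x ^ 4 + scalar (6 * m) * (var_x\<^sup>2 * var_y\<^sup>2) + var_y ^ 4"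

lemma biquadratic_eq_pencil:
  "biquadratic m = scalar 1 * (var_x ^ 4 + var_y ^ 4) + scalar (6 * m) * (var_x\<^sup>2 * var_y\<^sup>2)"
  by (simp add: biquadratic_def scalar_1)

lemma biquadratic_neq_0: "biquadratic m \<noteq> 0"
  unfolding biquadratic_eq_pencil by (rule biquadratic_pencil_neq_0) simp

lemma homogeneous_biquadratic: "homogeneous 4 (biquadratic m)"
  unfolding biquadratic_eq_pencil by (rule biquadratic_pencil_homogeneous)

text \<open>
  The j-invariant of \<open>biquadratic m\<close>: the numerator comes from the quartic invariant
  \<open>I = 1 + 3 m^2\<close> and the denominator is, up to a constant, the discriminant.
\<close>

definition biquadratic_j :: "complex \<Rightarrow> complex" where
  "biquadratic_j m = 1728 * (1 + 3 * m\<^sup>2) ^ 3 / (1 - 9 * m\<^sup>2)\<^sup>2"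

lemma value_biquadratic [simp]:
  "value_at (biquadratic m) v = (v $ 1) ^ 4 + 6 * m * ((v $ 1)\<^sup>2 * (v $ 2)\<^sup>2) + (v $ 2) ^ 4"
  by (simp add: biquadratic_def)

lemma value_linear_form [simp]: "value_at (linear_form a) v = a $ 1 * v $ 1 + a $ 2 * v $ 2"
  by (simp add: linear_form_eq)

text \<open>
  The case \<open>c = 0\<close> of the second hypothesis says that \<open>w\<close> is nonzero.
\<close>

lemma bracket_neq_0:
  assumes "\<And>c. v \<noteq> c *s w" "\<And>c. w \<noteq> c *s v"
  shows "bracket v w \<noteq> 0"
proof
  assume "bracket v w = 0"
  then have b: "v $ 1 * w $ 2 = v $ 2 * w $ 1" by (simp add: bracket_def)
  consider "w $ 1 \<noteq> 0" | "w $ 2 \<noteq> 0"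
    using assms(2)[of 0] by (auto simp: vec_eq_iff forall_2)
  then show False
  proof cases
    case 1
    then show False using b assms(1)[of "v $ 1 / w $ 1"]
      by (auto simp: vec_eq_iff forall_2 field_simps)
  next
    case 2
    then show False using b assms(1)[of "v $ 2 / w $ 2"]
      by (auto simp: vec_eq_iff forall_2 field_simps)
  qed
qed

lemma bracket_imp_not_proportional: "bracket v w \<noteq> 0 \<Longrightarrow> v \<noteq> c *s w"
  by (auto simp: bracket_def)

lemma linear_form_inject [simp]: "linear_form a = linear_form b \<longleftrightarrow> a = b"
proof
  assume "linear_form a = linear_form b"
  then have "value_at (linear_form a) v = value_at (linear_form b) v" for v by simp
  from this[of "vector [1, 0]"] this[of "vector [0, 1]"] show "a = b"
    by (simp add: vec_eq_iff forall_2)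
qed simp

lemma smult_linear_form: "smult [:c:] (linear_form a) = linear_form (c *s a)"
  by (rule bpoly_eqI_value) (simp add: smult_eq_scalar algebra_simps)

lemma fourth_root_complex: obtains z :: complex where "z ^ 4 = c"
proof
  have "z ^ 4 = (z\<^sup>2)\<^sup>2" for z :: complex by (simp flip: power_mult)
  then show "csqrt (csqrt c) ^ 4 = c" by (metis power2_csqrt)
qed

text \<open>
  Let \<open>X\<close>, \<open>Y\<close> be the first two factors. The other two multiply to
  \<open>r^2 X^2 + 2 s r t X Y + t^2 Y^2\<close>, and with \<open>r X = U + W\<close>, \<open>t Y = U - W\<close> the quartic becomes a
  multiple of \<open>(U^2 - W^2) ((1 + s) U^2 + (1 - s) W^2)\<close>, which contains only even powers. Scaling \<open>W\<close> by
  a fourth root \<open>\<gamma>\<close> makes the two outer coefficients equal. The last two factors are not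
  proportional exactly when \<open>s^2 \<noteq> 1\<close>, so this scaling is possible.
\<close>

lemma quartic_normal_form:
  fixes a b c d :: complex
  assumes "bracket u w \<noteq> 0" "a \<noteq> 0" "b \<noteq> 0" "c \<noteq> 0" "d \<noteq> 0" "a * d \<noteq> b * c"
  assumes f: "f = linear_form u * linear_form w *
    (scalar a * linear_form u + scalar b * linear_form w) *
    (scalar c * linear_form u + scalar d * linear_form w)"
  obtains m where "9 * m\<^sup>2 \<noteq> 1" "proj_equiv (biquadratic m) f"
proof -
  define r t where "r = csqrt (a * c)" and "t = csqrt (b * d)"
  have r: "r\<^sup>2 = a * c" "r \<noteq> 0" and t: "t\<^sup>2 = b * d" "t \<noteq> 0"
    using assms by (auto simp: r_def t_def)
  define s where "s = (a * d + b * c) / (2 * r * t)"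
  have s: "2 * s * r * t = a * d + b * c" using r t by (simp add: s_def)
  have "4 * (s\<^sup>2 - 1) * (r\<^sup>2 * t\<^sup>2) = (2 * s * r * t)\<^sup>2 - 4 * (r\<^sup>2 * t\<^sup>2)"
    by (simp add: algebra_simps power2_eq_square)
  also have "\<dots> = (a * d - b * c)\<^sup>2"
    unfolding s r t by (simp add: algebra_simps power2_eq_square)
  finally have s1: "s\<^sup>2 \<noteq> 1" using assms by auto
  then have s2: "s \<noteq> 1" "1 + s \<noteq> 0" by (auto simp: add_eq_0_iff)
  obtain \<gamma> where "\<gamma> ^ 4 = (s + 1) / (s - 1)" by (rule fourth_root_complex)
  then have g: "\<gamma> ^ 4 * (s - 1) = s + 1" using s2 by (simp add: divide_simps)
  then have g0: "\<gamma> \<noteq> 0" using s2 by (auto simp: add.commute)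
  define m where "m = - (s * \<gamma>\<^sup>2) / (3 * (1 + s))"
  have "6 * (- x / (3 * e)) * e = - 2 * x" if "e \<noteq> 0" for x e :: complex
    using that by simp
  from this[OF s2(2), of "s * \<gamma>\<^sup>2"] have m: "6 * m * (1 + s) = - 2 * s * \<gamma>\<^sup>2"
    by (simp only: m_def mult.assoc)
  have m1: "9 * m\<^sup>2 \<noteq> 1"
  proof
    assume "9 * m\<^sup>2 = 1"
    then have "4 * (1 + s)\<^sup>2 = (6 * m * (1 + s))\<^sup>2" by (simp add: power_mult_distrib)
    also have "\<dots> = 4 * s\<^sup>2 * \<gamma> ^ 4" unfolding m by (simp add: power_mult_distrib flip: power_mult)
    finally have "(1 + s) * ((1 + s) * (s - 1)) = (1 + s) * s\<^sup>2"
      using g by algebra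
    then have "(1 + s) * (s - 1) = s\<^sup>2" using s2 by simp
    then show False by (simp add: algebra_simps power2_eq_square)
  qed
  define U W :: "complex ^ 2" where
    "U = vector [(r * u $ 1 + t * w $ 1) / 2, (r * u $ 2 + t * w $ 2) / 2]" and
    "W = vector [(r * u $ 1 - t * w $ 1) / (2 * \<gamma>), (r * u $ 2 - t * w $ 2) / (2 * \<gamma>)]"
  define B :: "complex ^ 2 ^ 2" where "B = vector [U, W]"
  have "det B = - r * t / (2 * \<gamma>) * bracket u w"
    using g0 by (simp add: B_def det_2 U_def W_def bracket_def field_simps)
  then have B: "invertible B" using assms r t g0 by (simp add: invertible_det_nz)
  have "f = scalar (2 * (1 + s) / (r * t)) * change_vars B (biquadratic m)"
  proof (rule bpoly_eqI_value)
    fix v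
    define X Y where "X = value_at (linear_form u) v" and "Y = value_at (linear_form w) v"
    define p q where "p = (r * X + t * Y) / 2" and "q = (r * X - t * Y) / (2 * \<gamma>)"
    have "(B *v v) $ 1 = p" "(B *v v) $ 2 = q"
      using g0 by (simp_all add: B_def U_def W_def p_def q_def X_def Y_def
          matrix_vector_mult_def sum_2 field_simps)
    then have R: "value_at (scalar (2 * (1 + s) / (r * t)) * change_vars B (biquadratic m)) v
       = 2 * (1 + s) / (r * t) * (p ^ 4 + 6 * m * (p\<^sup>2 * q\<^sup>2) + q ^ 4)"
      by simp
    have X: "r * X = p + \<gamma> * q" and Y: "t * Y = p - \<gamma> * q"
      using g0 by (simp_all add: p_def q_def field_simps)
    have "r * t * value_at f v = (r * X) * (t * Y) * (a * c * X\<^sup>2 + (a * d + b * c) * (X * Y) + b * d * Y\<^sup>2)"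
      by (simp add: f X_def Y_def) algebra
    also have "\<dots> = (r * X) * (t * Y) * ((r * X)\<^sup>2 + 2 * s * (r * X) * (t * Y) + (t * Y)\<^sup>2)"
      unfolding r(1)[symmetric] t(1)[symmetric] s[symmetric] by algebra
    also have "\<dots> = 2 * (1 + s) * (p ^ 4 + 6 * m * (p\<^sup>2 * q\<^sup>2) + q ^ 4)"
      unfolding X Y using m g by algebra
    finally show "value_at f v = value_at (scalar (2 * (1 + s) / (r * t)) * change_vars B (biquadratic m)) v"
      unfolding R using r t by (simp add: field_simps)
  qed
  moreover have "2 * (1 + s) / (r * t) \<noteq> 0"
    using r(2) t(2) s2(2) by (metis divide_eq_0_iff mult_eq_0_iff zero_neq_numeral)
  ultimately have "proj_equiv (biquadratic m) f"
    by (intro proj_equivI[OF biquadratic_neq_0 homogeneous_biquadratic B])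
  with m1 show thesis by (rule that)
qed

text \<open>
  The first two linear factors form a basis of the linear forms, and Cramer's rule gives the
  coordinates of the other two; these are nonzero because no two factors are proportional.
\<close>

lemma smooth_quartic_normal_form:
  assumes "smooth_quartic f"
  obtains m where "9 * m\<^sup>2 \<noteq> 1" "proj_equiv (biquadratic m) f"
proof -
  obtain l where l: "f = (\<Prod>k<4::nat. l k)" "\<And>k. k < 4 \<Longrightarrow> homogeneous 1 (l k)"
    "\<And>k m c. k < 4 \<Longrightarrow> m < 4 \<Longrightarrow> k \<noteq> m \<Longrightarrow> l k \<noteq> smult [:c:] (l m)"
    using assms unfolding smooth_quartic_def by blast
  have "\<exists>a. l k = linear_form a" if "k < 4" for k
    using homogeneous_1_imp_linear_form[OF l(2)[OF that]] by metis
  then obtain a where a: "\<And>k. k < 4 \<Longrightarrow> l k = linear_form (a k)" by metis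
  have br: "bracket (a k) (a m) \<noteq> 0" if "k < 4" "m < 4" "k \<noteq> m" for k m
    using l(3) a that by (intro bracket_neq_0) (metis smult_linear_form)+
  define e where "e = bracket (a 0) (a 1)"
  have e: "e \<noteq> 0" using br by (simp add: e_def)
  have cramer: "linear_form w = scalar (bracket w (a 1) / e) * linear_form (a 0) +
     scalar (bracket (a 0) w / e) * linear_form (a 1)" for w
  proof (rule bpoly_eqI_value)
    fix v
    show "value_at (linear_form w) v = value_at (scalar (bracket w (a 1) / e) * linear_form (a 0) +
     scalar (bracket (a 0) w / e) * linear_form (a 1)) v"
      using e by (simp add: divide_simps) (simp add: e_def bracket_def algebra_simps)
  qed
  have "bracket (a 2) (a 1) / e * (bracket (a 0) (a 3) / e) - bracket (a 0) (a 2) / e * (bracket (a 3) (a 1) / e)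
     = bracket (a 2) (a 3) / e"
    using e by (simp add: divide_simps) (simp add: e_def bracket_def algebra_simps)
  moreover have "bracket (a 2) (a 3) / e \<noteq> 0" using br e by simp
  ultimately have ad: "bracket (a 2) (a 1) / e * (bracket (a 0) (a 3) / e) \<noteq>
     bracket (a 0) (a 2) / e * (bracket (a 3) (a 1) / e)"
    by (metis right_minus_eq)
  have f: "f = linear_form (a 0) * linear_form (a 1) * linear_form (a 2) * linear_form (a 3)"
    by (simp add: l(1) prod_less_4 a)
  show thesis
    by (rule quartic_normal_form[OF _ _ _ _ _ ad f[unfolded cramer[of "a 2"] cramer[of "a 3"]]])
      (use br e that in auto)
qed

text \<open>
  If \<open>a\<close> is a root, then the four roots are \<open>a\<close>, \<open>- a\<close>, \<open>1 / a\<close> and \<open>- 1 / a\<close>; they are distinct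
  because \<open>a^4 \<noteq> 1\<close>.
\<close>

lemma biquadratic_root:
  assumes "9 * m\<^sup>2 \<noteq> (1 :: complex)"
  obtains a where "a \<noteq> 0" "a ^ 4 \<noteq> 1" "a ^ 4 + 6 * m * a\<^sup>2 + 1 = 0"
proof -
  define s where "s = csqrt (9 * m\<^sup>2 - 1) - 3 * m"
  define a where "a = csqrt s"
  have "(s + 3 * m)\<^sup>2 = 9 * m\<^sup>2 - 1" by (simp add: s_def)
  then have s: "s\<^sup>2 + 6 * m * s + 1 = 0" by algebra
  have a2: "a\<^sup>2 = s" by (simp add: a_def)
  have a4: "a ^ 4 = s\<^sup>2" by (simp flip: a2 power_mult)
  have "s \<noteq> 0" using s by auto
  moreover have "s\<^sup>2 \<noteq> 1"
  proof
    assume "s\<^sup>2 = 1"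
    then have "(6 * m * s)\<^sup>2 = 4" "s\<^sup>2 = 1" using s by algebra+
    then show False using assms by (simp add: power_mult_distrib)
  qed
  ultimately show thesis using s a2 by (intro that[of a]) (auto simp: a4)
qed

lemma smooth_quartic_biquadratic:
  assumes "9 * m\<^sup>2 \<noteq> 1"
  shows "smooth_quartic (biquadratic m)"
proof -
  obtain a where a: "a \<noteq> 0" "a ^ 4 \<noteq> 1" "a ^ 4 + 6 * m * a\<^sup>2 + 1 = 0"
    by (rule biquadratic_root[OF assms])
  define w :: "nat \<Rightarrow> complex ^ 2" where
    "w = (\<lambda>k. [vector [1, a], vector [1, - a], vector [1, 1 / a], vector [1, - (1 / a)]] ! k)"
  have [simp]: "w 0 = vector [1, a]" "w (Suc 0) = vector [1, - a]" "w 2 = vector [1, 1 / a]"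
    "w 3 = vector [1, - (1 / a)]"
    by (simp_all add: w_def numeral_eq_Suc)
  have "a * a \<noteq> 1" "a * a \<noteq> - 1" using a(2) by (auto simp: power4_eq_xxxx mult.assoc)
  moreover from this have "- 1 \<noteq> a * a" "- (a * a) \<noteq> 1" "1 + a * a \<noteq> 0"
    by (metis minus_minus, metis minus_minus, metis add_eq_0_iff minus_minus)
  ultimately have "\<forall>k<4. \<forall>n<4. k \<noteq> n \<longrightarrow> bracket (w k) (w n) \<noteq> 0"
    using a(1) unfolding all_less_4
    by (auto simp: bracket_def field_simps power2_eq_square )
  moreover have "biquadratic m = (\<Prod>k<4. linear_form (w k))"
  proof (rule bpoly_eqI_value)
    fix v :: "complex ^ 2"
    have m: "6 * m = - (a\<^sup>2 + 1 / a\<^sup>2)"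
      using a by (simp add: field_simps power2_eq_square power4_eq_xxxx) algebra
    show "value_at (biquadratic m) v = value_at (\<Prod>k<4. linear_form (w k)) v"
      using a(1) unfolding prod_less_4 by (simp add: m) (simp add: field_simps power2_eq_square power4_eq_xxxx)
  qed
  ultimately show ?thesis unfolding smooth_quartic_def
    by (intro exI[of _ "\<lambda>k. linear_form (w k)"])
      (simp add: smult_linear_form bracket_imp_not_proportional homogeneous_linear_form del: One_nat_def)
qed

section \<open>The j-invariant\<close>

text \<open>
  Reordering four points moves their cross-ratio \<open>t\<close> within the orbit generated by \<open>1 / t\<close> and
  \<open>1 - t\<close>.
\<close>

lemma j_of_cross_ratio_inverse: "t \<noteq> 0 \<Longrightarrow> j_of_cross_ratio (1 / t) = j_of_cross_ratio t"
proof -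
  assume t: "t \<noteq> 0"
  have a: "(1 / t)\<^sup>2 - 1 / t + 1 = (t\<^sup>2 - t + 1) / t\<^sup>2"
    and b: "(1 / t)\<^sup>2 * (1 / t - 1)\<^sup>2 = t\<^sup>2 * (t - 1)\<^sup>2 / (t\<^sup>2) ^ 3"
    using t by (simp_all add: field_simps power2_eq_square power3_eq_cube)
  show ?thesis unfolding j_of_cross_ratio_def a b using t by (simp add: power_divide)
qed

lemma j_of_cross_ratio_complement: "j_of_cross_ratio (1 - t) = j_of_cross_ratio t"
proof -
  have "(1 - t)\<^sup>2 - (1 - t) + 1 = t\<^sup>2 - t + 1" "(1 - t)\<^sup>2 * (1 - t - 1)\<^sup>2 = t\<^sup>2 * (t - 1)\<^sup>2"
    by algebra+
  then show ?thesis unfolding j_of_cross_ratio_def by (simp only:)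
qed

text \<open>
  The argument is the cross-ratio of the roots in the order \<open>a\<close>, \<open>- a\<close>, \<open>1 / a\<close>, \<open>- 1 / a\<close>. With
  \<open>s = a^2\<close>, the parameter \<open>m\<close> is determined by \<open>6 m s = - (s^2 + 1)\<close>, so both sides are rational
  functions of \<open>s\<close>.
\<close>

lemma j_of_cross_ratio_biquadratic:
  assumes "a \<noteq> 0" "a ^ 4 \<noteq> 1" "a ^ 4 + 6 * m * a\<^sup>2 + 1 = 0"
  shows "j_of_cross_ratio (((a\<^sup>2 - 1) / (a\<^sup>2 + 1))\<^sup>2) = biquadratic_j m"
proof -
  define s where "s = a\<^sup>2"
  have a4: "a ^ 4 = s\<^sup>2" by (simp add: s_def flip: power_mult)
  have "(s - 1) * (s + 1) \<noteq> 0"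
    using assms(2) unfolding a4 by (simp add: algebra_simps power2_eq_square)
  then have s: "s \<noteq> 0" "s \<noteq> 1" "s + 1 \<noteq> 0" "s\<^sup>2 + 6 * m * s + 1 = 0"
    using assms(1,3) unfolding a4 by (auto simp: s_def)
  define t where "t = ((s - 1) / (s + 1))\<^sup>2"
  have t: "t * (s + 1)\<^sup>2 = (s - 1)\<^sup>2" using s by (simp add: t_def power_divide)
  have m: "6 * m * s = - (s\<^sup>2 + 1)" using s(4) by algebra
  have e1: "t\<^sup>2 - t + 1 = 12 * s\<^sup>2 * (1 + 3 * m\<^sup>2) / (s + 1) ^ 4"
  proof -
    have "(t\<^sup>2 - t + 1) * (s + 1) ^ 4
        = (t * (s + 1)\<^sup>2)\<^sup>2 - t * (s + 1)\<^sup>2 * (s + 1)\<^sup>2 + ((s + 1)\<^sup>2)\<^sup>2"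
      by algebra
    also have "\<dots> = (- (s\<^sup>2 + 1))\<^sup>2 + 12 * s\<^sup>2" unfolding t by algebra
    also have "\<dots> = 12 * s\<^sup>2 * (1 + 3 * m\<^sup>2)" unfolding m[symmetric] by algebra
    finally have "(t\<^sup>2 - t + 1) * (s + 1) ^ 4 = 12 * s\<^sup>2 * (1 + 3 * m\<^sup>2)" .
    then show ?thesis using s by (simp add: field_simps)
  qed
  have e2: "t\<^sup>2 * (t - 1)\<^sup>2 = 256 * s ^ 6 * (1 - 9 * m\<^sup>2)\<^sup>2 / (s + 1) ^ 12"
  proof -
    have u: "(t - 1) * (s + 1)\<^sup>2 = - 4 * s" using t by algebra
    have "4 * s\<^sup>2 * (1 - 9 * m\<^sup>2) = 4 * s\<^sup>2 - (6 * m * s)\<^sup>2" by algebra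
    also have "\<dots> = - ((s - 1) * (s + 1))\<^sup>2" unfolding m by algebra
    finally have v: "4 * s\<^sup>2 * (1 - 9 * m\<^sup>2) = - ((s - 1) * (s + 1))\<^sup>2" .
    have "t\<^sup>2 * (t - 1)\<^sup>2 * (s + 1) ^ 12 = (t * (s + 1)\<^sup>2)\<^sup>2 * ((t - 1) * (s + 1)\<^sup>2)\<^sup>2 * (s + 1) ^ 4"
      by algebra
    also have "\<dots> = 16 * s\<^sup>2 * (- ((s - 1) * (s + 1))\<^sup>2)\<^sup>2" unfolding t u by algebra
    also have "\<dots> = 256 * s ^ 6 * (1 - 9 * m\<^sup>2)\<^sup>2" unfolding v[symmetric] by algebra
    finally show ?thesis using s by (simp add: field_simps)
  qed
  have "j_of_cross_ratio t = biquadratic_j m"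
    unfolding j_of_cross_ratio_def e1 e2 biquadratic_j_def
    using s by (simp add: power_divide power_mult_distrib flip: power_mult)
  then show ?thesis by (simp add: t_def s_def)
qed

text \<open>
  In the affine chart the first point is some root \<open>a\<close>, and the other three are \<open>- a\<close>, \<open>b = 1 / a\<close> and
  \<open>- b\<close> in some order. Each of the six orders gives one of the six values in the orbit of the
  cross-ratio \<open>s\<close>, on which \<open>j_of_cross_ratio\<close> is constant.
\<close>

lemma cross_ratio_biquadratic_zeros:
  fixes w :: "nat \<Rightarrow> complex ^ 2"
  assumes "9 * m\<^sup>2 \<noteq> 1" "\<forall>k<4. w k \<in> zero_cone (biquadratic m)"
    and nonprop: "\<forall>k<4. \<forall>n<4. k \<noteq> n \<longrightarrow> bracket (w k) (w n) \<noteq> 0"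
  shows "j_of_cross_ratio (cross_ratio (w 0) (w 1) (w 2) (w 3)) = biquadratic_j m"
proof -
  have w: "w k \<noteq> 0" "value_at (biquadratic m) (w k) = 0" if "k < 4" for k :: nat
    using assms(2) that by (auto simp: zero_cone_def value_at_def)
  have w2: "w k $ 2 \<noteq> 0" if "k < 4" for k
    using w[OF that] by (auto simp: vec_eq_iff forall_2)
  define z where "z k = w k $ 1 / w k $ 2" for k
  have z1: "w k $ 1 = z k * w k $ 2" if "k < 4" for k using w2[OF that] by (simp add: z_def)
  have root: "z k ^ 4 + 6 * m * (z k)\<^sup>2 + 1 = 0" if "k < 4" for k
  proof -
    have "(z k ^ 4 + 6 * m * (z k)\<^sup>2 + 1) * (w k $ 2) ^ 4 = 0"
      using w(2)[OF that] unfolding value_biquadratic z1[OF that] by algebra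
    then show ?thesis using w2[OF that] by simp
  qed
  have br: "bracket (w k) (w n) = w k $ 2 * w n $ 2 * (z k - z n)" if "k < 4" "n < 4" for k n
    using that by (simp add: bracket_def z1 algebra_simps)
  have zneq: "z k \<noteq> z n" if "k < 4" "n < 4" "k \<noteq> n" for k n
    using nonprop that br[of k n] by auto
  have cr: "cross_ratio (w 0) (w 1) (w 2) (w 3)
      = ((z 0 - z 2) * (z 1 - z 3)) / ((z 0 - z 3) * (z 1 - z 2))"
    using w2 by (simp add: cross_ratio_def br)
  define a where "a = z 0"
  have a0: "a ^ 4 + 6 * m * a\<^sup>2 + 1 = 0" using root[of 0] by (simp add: a_def)
  have a1: "a \<noteq> 0" using a0 by auto
  have a2: "a ^ 4 \<noteq> 1"
  proof
    assume "a ^ 4 = 1"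
    then have "(6 * m * a\<^sup>2)\<^sup>2 = 4" using a0 by algebra
    then have "36 * m\<^sup>2 * a ^ 4 = 4" by (simp add: power_mult_distrib flip: power_mult)
    then show False using \<open>a ^ 4 = 1\<close> assms(1) by simp
  qed
  have cases: "z k \<in> {a, - a, 1 / a, - (1 / a)}" if "k < 4" for k
  proof -
    have "(z k - a) * (z k + a) * ((a * z k - 1) * (a * z k + 1))
        = a\<^sup>2 * (z k ^ 4 + 6 * m * (z k)\<^sup>2 + 1) - (z k)\<^sup>2 * (a ^ 4 + 6 * m * a\<^sup>2 + 1)"
      by algebra
    also have "\<dots> = 0" unfolding root[OF that] a0 by simp
    finally have "z k = a \<or> z k = - a \<or> a * z k = 1 \<or> a * z k = - 1"
      using a1 by (auto simp: eq_neg_iff_add_eq_0)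
    then show ?thesis using a1 by (auto simp: field_simps)
  qed
  define b p q where "b = 1 / a" and "p = a - b" and "q = a + b"
  have ab: "a * b = 1" using a1 by (simp add: b_def)
  then have ap: "a * p = a\<^sup>2 - 1" and aq: "a * q = a\<^sup>2 + 1"
    unfolding p_def q_def by algebra+
  have "(a\<^sup>2 - 1) * (a\<^sup>2 + 1) \<noteq> 0" using a2 by (simp add: algebra_simps flip: power_add)
  then have p: "p \<noteq> 0" and q: "q \<noteq> 0" and b1: "b \<noteq> 0" using ab by (auto simp flip: ap aq)
  define s where "s = (p * p) / (q * q)"
  have "s = ((a * p) / (a * q))\<^sup>2" using a1 by (simp add: s_def power2_eq_square)
  then have js: "j_of_cross_ratio s = biquadratic_j m"
    using j_of_cross_ratio_biquadratic[OF a1 a2 a0] by (simp add: ap aq)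
  have pq: "q * q - p * p = 2 * a * (2 * b)" unfolding p_def q_def by algebra
  have s1: "1 - s = 2 * a * (2 * b) / (q * q)"
    unfolding pq[symmetric] s_def using q by (simp add: diff_divide_distrib)
  have s2: "1 - 1 / s = 2 * a * (- (2 * b)) / (p * p)"
    unfolding mult_minus_right pq[symmetric] s_def using p q by (simp add: diff_divide_distrib)
  have s: "s \<noteq> 0" "1 - s \<noteq> 0" "1 - 1 / s \<noteq> 0"
    unfolding s1 s2 using p q a1 b1 by (auto simp: s_def)
  have inv: "j_of_cross_ratio (1 / t) = biquadratic_j m" if "j_of_cross_ratio t = biquadratic_j m" "t \<noteq> 0" for t
    using that by (simp add: j_of_cross_ratio_inverse)
  have orbit: "j_of_cross_ratio t = biquadratic_j m"
    if "t \<in> {s, 1 / s, 1 - s, 1 / (1 - s), 1 - 1 / s, 1 / (1 - 1 / s)}" for t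
    using that s js by (auto intro!: inv simp: j_of_cross_ratio_complement j_of_cross_ratio_inverse)
  have n: "z 1 \<noteq> a" "z 2 \<noteq> a" "z 3 \<noteq> a" "z 1 \<noteq> z 2" "z 1 \<noteq> z 3" "z 2 \<noteq> z 3"
    unfolding a_def by (intro zneq; simp)+
  consider "z 1 = - a" "z 2 = 1 / a" "z 3 = - (1 / a)" | "z 1 = - a" "z 3 = 1 / a" "z 2 = - (1 / a)"
    | "z 2 = - a" "z 1 = 1 / a" "z 3 = - (1 / a)" | "z 2 = - a" "z 3 = 1 / a" "z 1 = - (1 / a)"
    | "z 3 = - a" "z 1 = 1 / a" "z 2 = - (1 / a)" | "z 3 = - a" "z 2 = 1 / a" "z 1 = - (1 / a)"
    using cases[of 1] cases[of 2] cases[of 3] n by auto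
  then have "((z 0 - z 2) * (z 1 - z 3)) / ((z 0 - z 3) * (z 1 - z 2))
    \<in> {s, 1 / s, 1 - s, 1 / (1 - s), 1 - 1 / s, 1 / (1 - 1 / s)}"
  proof cases
    case 1
    have "z 0 - z 2 = p" "z 1 - z 3 = - p" "z 0 - z 3 = q" "z 1 - z 2 = - q"
      unfolding 1 p_def q_def a_def[symmetric] b_def[symmetric] by simp_all
    then have "((z 0 - z 2) * (z 1 - z 3)) / ((z 0 - z 3) * (z 1 - z 2)) = s"
      unfolding s_def by simp
    then show ?thesis by blast
  next
    case 2
    have "z 0 - z 2 = q" "z 1 - z 3 = - q" "z 0 - z 3 = p" "z 1 - z 2 = - p"
      unfolding 2 p_def q_def a_def[symmetric] b_def[symmetric] by simp_all
    then have "((z 0 - z 2) * (z 1 - z 3)) / ((z 0 - z 3) * (z 1 - z 2)) = 1 / s"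
      unfolding s_def by simp
    then show ?thesis by blast
  next
    case 3
    have "z 0 - z 2 = 2 * a" "z 1 - z 3 = 2 * b" "z 0 - z 3 = q" "z 1 - z 2 = q"
      unfolding 3 p_def q_def a_def[symmetric] b_def[symmetric] by simp_all
    then have "((z 0 - z 2) * (z 1 - z 3)) / ((z 0 - z 3) * (z 1 - z 2)) = 1 - s"
      unfolding s1 by simp
    then show ?thesis by blast
  next
    case 4
    have "z 0 - z 2 = 2 * a" "z 1 - z 3 = - (2 * b)" "z 0 - z 3 = p" "z 1 - z 2 = p"
      unfolding 4 p_def q_def a_def[symmetric] b_def[symmetric] by simp_all
    then have "((z 0 - z 2) * (z 1 - z 3)) / ((z 0 - z 3) * (z 1 - z 2)) = 1 - 1 / s"
      unfolding s2 by simp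
    then show ?thesis by blast
  next
    case 5
    have "z 0 - z 2 = q" "z 1 - z 3 = q" "z 0 - z 3 = 2 * a" "z 1 - z 2 = 2 * b"
      unfolding 5 p_def q_def a_def[symmetric] b_def[symmetric] by simp_all
    then have "((z 0 - z 2) * (z 1 - z 3)) / ((z 0 - z 3) * (z 1 - z 2)) = 1 / (1 - s)"
      unfolding s1 by simp
    then show ?thesis by blast
  next
    case 6
    have "z 0 - z 2 = p" "z 1 - z 3 = p" "z 0 - z 3 = 2 * a" "z 1 - z 2 = - (2 * b)"
      unfolding 6 p_def q_def a_def[symmetric] b_def[symmetric] by simp_all
    then have "((z 0 - z 2) * (z 1 - z 3)) / ((z 0 - z 3) * (z 1 - z 2)) = 1 / (1 - 1 / s)"
      unfolding s2 by simp
    then show ?thesis by blast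
  qed
  then show ?thesis unfolding cr by (rule orbit)
qed

lemma bracket_matrix_mult: "bracket (B *v v) (B *v w) = det B * bracket v w"
  by (simp add: bracket_def matrix_vector_mult_def sum_2 det_2 algebra_simps)

text \<open>
  The substitution matrix maps the zeros of \<open>f\<close> to those of the biquadratic form and preserves
  cross-ratios, since it multiplies every bracket by the same determinant.
\<close>

lemma j_invariant_biquadratic:
  assumes m: "9 * m\<^sup>2 \<noteq> 1" and f: "proj_equiv (biquadratic m) f"
  shows "j_invariant f = biquadratic_j m"
proof -
  obtain d B c where B: "invertible B" "c \<noteq> 0" "f = scalar c * change_vars B (biquadratic m)"
    using f by (rule proj_equivE)
  have detB: "det B \<noteq> 0" using B by (simp add: invertible_det_nz)
  obtain A where A: "B ** A = mat 1" "A ** B = mat 1" using B(1) by (auto simp: invertible_def)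
  have cone: "v \<in> zero_cone f \<longleftrightarrow> B *v v \<in> zero_cone (biquadratic m)" for v
  proof -
    have "B *v v = 0 \<longleftrightarrow> v = 0"
      by (metis A(2) matrix_vector_mul_assoc matrix_vector_mul_lid matrix_vector_mult_0_right)
    moreover have "value_at f v = c * value_at (biquadratic m) (B *v v)"
      unfolding B by (simp only: value_simps value_change_vars)
    ultimately show ?thesis using B(2) by (simp add: zero_cone_def flip: value_at_def)
  qed
  have cr: "cross_ratio (B *v v1) (B *v v2) (B *v v3) (B *v v4) = cross_ratio v1 v2 v3 v4" for v1 v2 v3 v4
    unfolding cross_ratio_def bracket_matrix_mult using detB by simp
  obtain a where a: "a \<noteq> 0" "a ^ 4 \<noteq> 1" "a ^ 4 + 6 * m * a\<^sup>2 + 1 = 0"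
    by (rule biquadratic_root[OF m])
  define w :: "nat \<Rightarrow> complex ^ 2" where
    "w = (\<lambda>k. [vector [1, a], vector [1, - a], vector [a, 1], vector [- a, 1]] ! k)"
  have [simp]: "w 0 = vector [1, a]" "w (Suc 0) = vector [1, - a]" "w 2 = vector [a, 1]"
    "w 3 = vector [- a, 1]"
    by (simp_all add: w_def numeral_eq_Suc)
  have w: "\<forall>k<4. w k \<in> zero_cone (biquadratic m)"
    unfolding all_less_4 zero_cone_def using a
    by (simp add: vec_eq_iff forall_2 algebra_simps flip: value_at_def)
  have "a * a \<noteq> 1" "a * a \<noteq> - 1" using a(2) by (auto simp: power4_eq_xxxx mult.assoc)
  moreover from this have "- 1 \<noteq> a * a" "- (a * a) \<noteq> 1" "1 + a * a \<noteq> 0" "- 1 - a * a \<noteq> 0"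
    by (metis minus_minus, metis minus_minus, metis add_eq_0_iff minus_minus, metis add_eq_0_iff minus_minus diff_eq_eq add_0)
  ultimately have wbr: "\<forall>k<4. \<forall>n<4. k \<noteq> n \<longrightarrow> bracket (w k) (w n) \<noteq> 0"
    using a(1) unfolding all_less_4 by (auto simp: bracket_def)
  have all_values: "(\<exists>v :: nat \<Rightarrow> complex ^ 2.
     (\<forall>k<4. v k \<in> zero_cone f) \<and>
     (\<forall>k<4. \<forall>m<4. k \<noteq> m \<longrightarrow> (\<forall>c. v k \<noteq> c *s v m)) \<and>
     z = j_of_cross_ratio (cross_ratio (v 0) (v 1) (v 2) (v 3))) \<longleftrightarrow> z = biquadratic_j m" for z
  proof (intro iffI; (elim exE conjE)?)
    fix v :: "nat \<Rightarrow> complex ^ 2"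
    assume v: "\<forall>k<4. v k \<in> zero_cone f" "\<forall>k<4. \<forall>m<4. k \<noteq> m \<longrightarrow> (\<forall>c. v k \<noteq> c *s v m)"
      and z: "z = j_of_cross_ratio (cross_ratio (v 0) (v 1) (v 2) (v 3))"
    have "bracket (B *v v k) (B *v v n) \<noteq> 0" if "k < 4" "n < 4" "k \<noteq> n" for k n
      unfolding bracket_matrix_mult using v(2) that detB bracket_neq_0[of "v k" "v n"] by auto
    then show "z = biquadratic_j m"
      using cross_ratio_biquadratic_zeros[OF m, of "\<lambda>k. B *v v k"] v(1) by (simp add: z cr cone)
  next
    assume z: "z = biquadratic_j m"
    define v where "v k = A *v w k" for k
    have Bv: "B *v v k = w k" for k by (simp add: v_def matrix_vector_mul_assoc A)
    have "det B * bracket (v k) (v n) \<noteq> 0" if "k < 4" "n < 4" "k \<noteq> n" for k n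
      using wbr that unfolding bracket_matrix_mult[symmetric] Bv by blast
    then have "\<forall>k<4. \<forall>m<4. k \<noteq> m \<longrightarrow> (\<forall>c. v k \<noteq> c *s v m)"
      by (metis bracket_imp_not_proportional mult_zero_right)
    moreover have "z = j_of_cross_ratio (cross_ratio (v 0) (v 1) (v 2) (v 3))"
      unfolding z cross_ratio_biquadratic_zeros[OF m w wbr, symmetric] Bv[symmetric] cr ..
    ultimately show "\<exists>v :: nat \<Rightarrow> complex ^ 2.
     (\<forall>k<4. v k \<in> zero_cone f) \<and>
     (\<forall>k<4. \<forall>m<4. k \<noteq> m \<longrightarrow> (\<forall>c. v k \<noteq> c *s v m)) \<and>
     z = j_of_cross_ratio (cross_ratio (v 0) (v 1) (v 2) (v 3))"
      using w by (intro exI[of _ v]) (auto simp: cone Bv)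
  qed
  then show ?thesis unfolding j_invariant_def all_values by simp
qed

lemma proj_equiv_biquadraticI:
  assumes "a * d \<noteq> b * c" "e \<noteq> 0"
    and "\<And>x y. e * ((a * x + b * y) ^ 4 + 6 * m * ((a * x + b * y)\<^sup>2 * (c * x + d * y)\<^sup>2) + (c * x + d * y) ^ 4)
      = x ^ 4 + 6 * n * (x\<^sup>2 * y\<^sup>2) + y ^ 4"
  shows "proj_equiv (biquadratic m) (biquadratic n)"
proof (rule proj_equivI[OF biquadratic_neq_0 homogeneous_biquadratic])
  define B :: "complex ^ 2 ^ 2" where "B = vector [vector [a, b], vector [c, d]]"
  show "invertible B" using assms(1) by (simp add: invertible_det_nz det_2 B_def)
  show "biquadratic n = scalar e * change_vars B (biquadratic m)"
    by (rule bpoly_eqI_value) (simp add: B_def matrix_vector_mult_def sum_2 flip: assms(3))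
qed fact

lemma proj_equiv_biquadratic_uminus: "proj_equiv (biquadratic m) (biquadratic (- m))"
  by (rule proj_equiv_biquadraticI[of \<i> 1 0 0 1]) (simp_all add: power_mult_distrib)

lemma proj_equiv_biquadratic_moebius:
  assumes "n * (1 + 3 * m) = 1 - m" "1 + 3 * m \<noteq> 0"
  shows "proj_equiv (biquadratic m) (biquadratic n)"
proof (rule proj_equiv_biquadraticI[of 1 "-1" 1 1 "1 / (2 * (1 + 3 * m))"])
  have nz: "2 * (1 + 3 * m) \<noteq> 0" using assms(2) by (metis mult_eq_0_iff zero_neq_numeral)
  then show "1 / (2 * (1 + 3 * m)) \<noteq> 0" by (metis divide_eq_0_iff one_neq_zero)
  have divide: "1 / k * u = v" if "k \<noteq> 0" "u = k * v" for k u v :: complex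
    using that by simp
  fix x y
  have "(1 * x + 1 * y) ^ 4 + 6 * m * ((1 * x + 1 * y)\<^sup>2 * (1 * x + - 1 * y)\<^sup>2) + (1 * x + - 1 * y) ^ 4
    = 2 * (1 + 3 * m) * (x ^ 4 + 6 * n * (x\<^sup>2 * y\<^sup>2) + y ^ 4)"
    using assms(1) by algebra
  then show "1 / (2 * (1 + 3 * m)) * ((1 * x + 1 * y) ^ 4 + 6 * m * ((1 * x + 1 * y)\<^sup>2 * (1 * x + - 1 * y)\<^sup>2) + (1 * x + - 1 * y) ^ 4)
    = x ^ 4 + 6 * n * (x\<^sup>2 * y\<^sup>2) + y ^ 4"
    by (rule divide[OF nz])
qed simp

text \<open>
  After clearing denominators, \<open>j(m) = j(n)\<close> is a polynomial equation that splits into six factors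
  linear in \<open>n\<close>. Their zeros are \<open>m\<close>, \<open>(1 - m) / (1 + 3 m)\<close>, \<open>(1 + m) / (1 - 3 m)\<close> and the negatives
  of these, all of which are reached by \<open>m \<mapsto> - m\<close> and \<open>m \<mapsto> (1 - m) / (1 + 3 m)\<close>.
\<close>

lemma proj_equiv_biquadratic:
  assumes m: "9 * m\<^sup>2 \<noteq> 1" and n: "9 * n\<^sup>2 \<noteq> 1" and j: "biquadratic_j m = biquadratic_j n"
  shows "proj_equiv (biquadratic m) (biquadratic n)"
proof -
  have d: "1 - 9 * m\<^sup>2 \<noteq> 0" "1 - 9 * n\<^sup>2 \<noteq> 0" using m n by auto
  have "(1 + 3 * m\<^sup>2) ^ 3 * (1 - 9 * n\<^sup>2)\<^sup>2 = (1 + 3 * n\<^sup>2) ^ 3 * (1 - 9 * m\<^sup>2)\<^sup>2"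
  proof -
    have "x * e = y * c" if "1728 * x / c = 1728 * y / e" "c \<noteq> 0" "e \<noteq> 0" for x y c e :: complex
      using that by (simp add: frac_eq_eq)
    from this[OF j[unfolded biquadratic_j_def]] show ?thesis using d by simp
  qed
  moreover have "- 27 * (((n - m) * (n + m)) * (((n * (1 + 3 * m) - (1 - m)) * (n * (1 + 3 * m) + (1 - m))) *
     ((n * (1 - 3 * m) - (1 + m)) * (n * (1 - 3 * m) + (1 + m)))))
     = (1 + 3 * m\<^sup>2) ^ 3 * (1 - 9 * n\<^sup>2)\<^sup>2 - (1 + 3 * n\<^sup>2) ^ 3 * (1 - 9 * m\<^sup>2)\<^sup>2"
    by (simp add: algebra_simps power2_eq_square power3_eq_cube)
  ultimately have "((n - m) * (n + m)) * (((n * (1 + 3 * m) - (1 - m)) * (n * (1 + 3 * m) + (1 - m))) *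
     ((n * (1 - 3 * m) - (1 + m)) * (n * (1 - 3 * m) + (1 + m)))) = 0"
    by simp
  then consider "n - m = 0" | "n + m = 0" | "n * (1 + 3 * m) - (1 - m) = 0" | "n * (1 + 3 * m) + (1 - m) = 0"
    | "n * (1 - 3 * m) - (1 + m) = 0" | "n * (1 - 3 * m) + (1 + m) = 0"
    unfolding mult_eq_0_iff by blast
  moreover have "(1 + 3 * m) * (1 + 3 * (- m)) = 1 - 9 * m\<^sup>2" by algebra
  then have k: "1 + 3 * m \<noteq> 0" "1 + 3 * (- m) \<noteq> 0" using d(1) by (metis mult_eq_0_iff)+
  note u = proj_equiv_biquadratic_uminus and mo = proj_equiv_biquadratic_moebius
  ultimately show ?thesis
  proof cases
    case 1
    then have "n = m" by algebra
    then show ?thesis using proj_equiv_trans[OF u[of m] u[of "- m"]] by simp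
  next
    case 2
    then have "n = - m" by algebra
    then show ?thesis using u by simp
  next
    case 3
    then have "n * (1 + 3 * m) = 1 - m" by algebra
    then show ?thesis using mo k by blast
  next
    case 4
    then have "(- n) * (1 + 3 * m) = 1 - m" by algebra
    from proj_equiv_trans[OF mo[OF this k(1)] u] show ?thesis by simp
  next
    case 5
    then have "n * (1 + 3 * (- m)) = 1 - (- m)" by algebra
    from proj_equiv_trans[OF u mo[OF this k(2)]] show ?thesis .
  next
    case 6
    then have "(- n) * (1 + 3 * (- m)) = 1 - (- m)" by algebra
    from proj_equiv_trans[OF proj_equiv_trans[OF u mo[OF this k(2)]] u] show ?thesis by simp
  qed
qed

section \<open>Macaulay duality under linear substitutions\<close>

text \<open>
  The polynomials among which \<open>mac f\<close> is chosen.
\<close>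

definition macaulay_dual :: "bpoly \<Rightarrow> bpoly \<Rightarrow> bool" where
  "macaulay_dual f g \<longleftrightarrow> g \<noteq> 0 \<and> homogeneous 4 g \<and> jacobian_ideal f = annihilator g"

lemma jacobian_idealI: "p = a * deriv_x f + b * deriv_y f \<Longrightarrow> p \<in> jacobian_ideal f"
  unfolding jacobian_ideal_def by blast

lemma jacobian_ideal_add:
  assumes "p \<in> jacobian_ideal f" "q \<in> jacobian_ideal f"
  shows "p + q \<in> jacobian_ideal f"
proof -
  obtain a b c d where "p = a * deriv_x f + b * deriv_y f" "q = c * deriv_x f + d * deriv_y f"
    using assms unfolding jacobian_ideal_def by blast
  then show ?thesis by (intro jacobian_idealI[of _ "a + c" _ "b + d"]) (simp add: algebra_simps)
qed

lemma jacobian_ideal_mult: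
  assumes "p \<in> jacobian_ideal f"
  shows "q * p \<in> jacobian_ideal f"
proof -
  obtain a b where "p = a * deriv_x f + b * deriv_y f"
    using assms unfolding jacobian_ideal_def by blast
  then show ?thesis by (intro jacobian_idealI[of _ "q * a" _ "q * b"]) (simp add: algebra_simps)
qed

lemma jacobian_ideal_change_vars_subset:
  assumes "invertible B"
  shows "jacobian_ideal (scalar c * change_vars B f) \<subseteq> change_vars B ` jacobian_ideal f"
proof
  fix p
  assume "p \<in> jacobian_ideal (scalar c * change_vars B f)"
  then obtain a b where p: "p = a * deriv_x (scalar c * change_vars B f) + b * deriv_y (scalar c * change_vars B f)"
    unfolding jacobian_ideal_def by blast
  obtain A where A: "\<And>p. change_vars B (change_vars A p) = p"
    using change_vars_inverse[OF assms] by metis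
  let ?a = "scalar c * (a * scalar (B $ 1 $ 1) + b * scalar (B $ 1 $ 2))"
  let ?b = "scalar c * (a * scalar (B $ 2 $ 1) + b * scalar (B $ 2 $ 2))"
  have "p = change_vars B (change_vars A ?a * deriv_x f + change_vars A ?b * deriv_y f)"
    unfolding change_vars_hom(1)[of B] change_vars_hom(2)[of B] A
    by (simp add: p deriv_change_vars algebra_simps)
  then show "p \<in> change_vars B ` jacobian_ideal f" by (blast intro: jacobian_idealI)
qed

text \<open>
  The chain rule gives one inclusion; the other one is the same inclusion for the inverse
  substitution.
\<close>

lemma jacobian_ideal_change_vars:
  assumes "invertible B" "c \<noteq> 0"
  shows "jacobian_ideal (scalar c * change_vars B f) = change_vars B ` jacobian_ideal f"
proof (rule antisym[OF jacobian_ideal_change_vars_subset[OF assms(1)]])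
  obtain A where A: "invertible A" "\<And>p. change_vars A (change_vars B p) = p" "\<And>p. change_vars B (change_vars A p) = p"
    using change_vars_inverse[OF assms(1)] by metis
  have "scalar (1 / c) * change_vars A (scalar c * change_vars B f) = f"
    using assms(2) by (simp add: A flip: mult.assoc scalar_mult) (simp add: scalar_1)
  then have "jacobian_ideal f \<subseteq> change_vars A ` jacobian_ideal (scalar c * change_vars B f)"
    using jacobian_ideal_change_vars_subset[OF A(1), of "1 / c" "scalar c * change_vars B f"] by simp
  then show "change_vars B ` jacobian_ideal f \<subseteq> jacobian_ideal (scalar c * change_vars B f)"
    using A(3) by fastforce
qed

lemma annihilator_change_vars:
  assumes "invertible B" "B ** transpose C = mat 1" "invertible C"
  shows "annihilator (change_vars C g) = change_vars B ` annihilator g"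
proof -
  obtain A where A: "\<And>p. change_vars B (change_vars A p) = p"
    using change_vars_inverse[OF assms(1)] by metis
  have "change_vars B p \<in> annihilator (change_vars C g) \<longleftrightarrow> p \<in> annihilator g" for p
    by (simp add: annihilator_def diff_action_change_vars assms change_vars_eq_0_iff)
  then show ?thesis using A by (metis (no_types, opaque_lifting) image_iff subsetI subset_antisym)
qed

lemma macaulay_dual_change_vars:
  assumes "macaulay_dual f g" "c \<noteq> 0" and AB: "B ** A = mat 1" "A ** B = mat 1"
  shows "macaulay_dual (scalar c * change_vars B f) (change_vars (transpose A) g)"
proof -
  have B: "invertible B" using AB by (auto simp: invertible_def)
  have "invertible A" using AB by (auto simp: invertible_def)
  then have A: "invertible (transpose A)" by (simp add: invertible_det_nz)
  show ?thesis
    using assms(1) unfolding macaulay_dual_def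
    by (simp add: jacobian_ideal_change_vars[OF B assms(2)] annihilator_change_vars[OF B _ A] AB
      change_vars_eq_0_iff[OF A] homogeneous_change_vars)
qed

section \<open>Macaulay and Hessian polynomials of biquadratic forms\<close>

definition biquadratic_mac :: "complex \<Rightarrow> bpoly" where
  "biquadratic_mac m = scalar m * (var_x ^ 4 + var_y ^ 4) + scalar (- 2) * (var_x\<^sup>2 * var_y\<^sup>2)"

definition biquadratic_hess :: "complex \<Rightarrow> bpoly" where
  "biquadratic_hess m = scalar m * (var_x ^ 4 + var_y ^ 4) + scalar (1 - 3 * m\<^sup>2) * (var_x\<^sup>2 * var_y\<^sup>2)"

lemma deriv_biquadratic:
  "deriv_x (biquadratic m) = scalar 4 * (var_x ^ 3 + scalar (3 * m) * (var_x * var_y\<^sup>2))"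
  "deriv_y (biquadratic m) = scalar 4 * (var_y ^ 3 + scalar (3 * m) * (var_x\<^sup>2 * var_y))"
  by (simp_all add: biquadratic_def power4_eq_xxxx power2_eq_square power3_eq_cube scalar_hom algebra_simps)

lemma hess_biquadratic: "hess (biquadratic m) = scalar 144 * biquadratic_hess m"
  unfolding hess_eq deriv_biquadratic
  by (rule bpoly_eqI_value)
    (simp add: biquadratic_hess_def power4_eq_xxxx power2_eq_square power3_eq_cube algebra_simps)

text \<open>
  A combination of monomials that span the quotient of C[x,y] by the Jacobian ideal of a smooth
  biquadratic form. There is one monomial in each of the degrees 0 and 4, two in the degrees 1 and 3,
  and three in degree 2.
\<close>

definition standard_form :: "complex \<Rightarrow> complex \<Rightarrow> complex \<Rightarrow> complex \<Rightarrow> complex \<Rightarrow> complex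
    \<Rightarrow> complex \<Rightarrow> complex \<Rightarrow> complex \<Rightarrow> bpoly" where
  "standard_form a a1 a2 b0 b1 b2 d1 d2 e = scalar a + scalar a1 * var_x + scalar a2 * var_y
     + scalar b0 * var_x\<^sup>2 + scalar b1 * (var_x * var_y) + scalar b2 * var_y\<^sup>2
     + scalar d1 * (var_x\<^sup>2 * var_y) + scalar d2 * (var_x * var_y\<^sup>2) + scalar e * (var_x\<^sup>2 * var_y\<^sup>2)"

text \<open>
  Every coefficient of the operator can be read off from the result, except that \<open>b0\<close> and \<open>b2\<close> are
  mixed by a matrix with determinant \<open>16 (9 m^2 - 1)\<close>. So for \<open>9 m^2 \<noteq> 1\<close> only the zero standard form
  annihilates \<open>biquadratic_mac m\<close>.
\<close>

lemma standard_form_action: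
  "diff_action (standard_form a a1 a2 b0 b1 b2 d1 d2 e) (biquadratic_mac m) =
    [:[:- 8 * e, - 8 * d2, 12 * m * b0 - 4 * b2, 4 * m * a1, m * a:],
      [:- 8 * d1, - 8 * b1, - 4 * a2:], [:12 * m * b2 - 4 * b0, - 4 * a1, - 2 * a:],
      [:4 * m * a2:], [:m * a:]:]"
proof -
  have eq: "[:[:c00, c10, c20, c30, c40:], [:c01, c11, c21:], [:c02, c12, c22:], [:c03:], [:c04:]:]
    = scalar c00 + scalar c10 * var_x + scalar c20 * var_x\<^sup>2 + scalar c30 * var_x ^ 3 + scalar c40 * var_x ^ 4
    + var_y * (scalar c01 + scalar c11 * var_x + scalar c21 * var_x\<^sup>2)
    + var_y\<^sup>2 * (scalar c02 + scalar c12 * var_x + scalar c22 * var_x\<^sup>2)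
    + var_y ^ 3 * scalar c03 + var_y ^ 4 * scalar c04"
    for c00 c10 c20 c30 c40 c01 c11 c21 c02 c12 c22 c03 c04
    by (rule bpoly_eqI_value)
      (simp add: value_at_def scalar_def var_x_def var_y_def power2_eq_square power3_eq_cube power4_eq_xxxx algebra_simps)
  show ?thesis unfolding eq
    by (simp add: standard_form_def biquadratic_mac_def power4_eq_xxxx power2_eq_square power3_eq_cube scalar_hom algebra_simps)
qed

text \<open>
  The Jacobian ideal is generated by \<open>u = x^3 + 3 m x y^2\<close> and \<open>v = y^3 + 3 m x^2 y\<close>, which rewrite
  \<open>x^3\<close> and \<open>y^3\<close>. Moreover \<open>y u - 3 m x v = (1 - 9 m^2) x^3 y\<close>, so \<open>x^3 y\<close> and, by symmetry, \<open>x y^3\<close>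
  lie in the ideal. With these reductions the standard forms modulo the ideal are closed under
  multiplication by \<open>x\<close> and \<open>y\<close>.
\<close>

lemma standard_form_exists:
  assumes m: "9 * m\<^sup>2 \<noteq> 1"
  shows "\<exists>a a1 a2 b0 b1 b2 d1 d2 e. \<exists>q \<in> jacobian_ideal (biquadratic m).
    p = q + standard_form a a1 a2 b0 b1 b2 d1 d2 e"
proof -
  define J where "J = jacobian_ideal (biquadratic m)"
  define P where "P p \<longleftrightarrow> (\<exists>a a1 a2 b0 b1 b2 d1 d2 e. \<exists>q \<in> J.
    p = q + standard_form a a1 a2 b0 b1 b2 d1 d2 e)" for p
  define u v where "u = var_x ^ 3 + scalar (3 * m) * (var_x * var_y\<^sup>2)"
    and "v = var_y ^ 3 + scalar (3 * m) * (var_x\<^sup>2 * var_y)"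
  have J_add: "p + q \<in> J" if "p \<in> J" "q \<in> J" for p q
    using that unfolding J_def by (rule jacobian_ideal_add)
  have J_mult: "q * p \<in> J" if "p \<in> J" for p q
    using that unfolding J_def by (rule jacobian_ideal_mult)
  have quarter: "scalar (1 / 4) * (scalar 4 * p) = p" for p
    by (simp add: scalar_1 flip: mult.assoc scalar_mult)
  have u: "u \<in> J" and v: "v \<in> J"
    unfolding J_def u_def v_def
    by (rule jacobian_idealI[of _ "scalar (1 / 4)" _ 0], simp add: deriv_biquadratic quarter)
      (rule jacobian_idealI[of _ 0 _ "scalar (1 / 4)"], simp add: deriv_biquadratic quarter)
  define k where "k = 1 / (1 - 9 * m\<^sup>2)"
  have k: "k * (1 - 9 * m\<^sup>2) = 1" using m by (simp add: k_def)
  have sk: "scalar k * (1 - 9 * (scalar m)\<^sup>2) = 1"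
    using arg_cong[OF k, of scalar] by (simp add: scalar_hom)
  have "var_x ^ 3 * var_y = (scalar k * var_y) * u + (scalar (- 3 * m * k) * var_x) * v"
    unfolding u_def v_def scalar_hom using sk by algebra
  then have x3y: "var_x ^ 3 * var_y \<in> J" using J_add J_mult u v by metis
  have "var_x * var_y ^ 3 = (scalar k * var_x) * v + (scalar (- 3 * m * k) * var_y) * u"
    unfolding u_def v_def scalar_hom using sk by algebra
  then have xy3: "var_x * var_y ^ 3 \<in> J" using J_add J_mult u v by metis
  have P_scalar: "P (scalar c * p)" if p: "P p" for c p
  proof -
    obtain a a1 a2 b0 b1 b2 d1 d2 e q where q: "q \<in> J" "p = q + standard_form a a1 a2 b0 b1 b2 d1 d2 e"
      using p unfolding P_def by blast
    have "scalar c * p = scalar c * q + standard_form (c * a) (c * a1) (c * a2)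
        (c * b0) (c * b1) (c * b2) (c * d1) (c * d2) (c * e)"
      by (simp add: q standard_form_def scalar_hom algebra_simps)
    then show ?thesis unfolding P_def using J_mult[OF q(1)] by blast
  qed
  have P_add: "P (p + p')" if p: "P p" and p': "P p'" for p p'
  proof -
    obtain a a1 a2 b0 b1 b2 d1 d2 e q where q: "q \<in> J" "p = q + standard_form a a1 a2 b0 b1 b2 d1 d2 e"
      using p unfolding P_def by blast
    obtain a' a1' a2' b0' b1' b2' d1' d2' e' q'
      where q': "q' \<in> J" "p' = q' + standard_form a' a1' a2' b0' b1' b2' d1' d2' e'"
      using p' unfolding P_def by blast
    have "p + p' = (q + q') + standard_form (a + a') (a1 + a1') (a2 + a2') (b0 + b0') (b1 + b1')
        (b2 + b2') (d1 + d1') (d2 + d2') (e + e')"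
      by (simp add: q q' standard_form_def scalar_hom algebra_simps)
    then show ?thesis unfolding P_def using J_add[OF q(1) q'(1)] by blast
  qed
  have P_x: "P (var_x * p)" if p: "P p" for p
  proof -
    obtain a a1 a2 b0 b1 b2 d1 d2 e q where q: "q \<in> J" "p = q + standard_form a a1 a2 b0 b1 b2 d1 d2 e"
      using p unfolding P_def by blast
    have "var_x * p = (var_x * q + (scalar b0 * u + (scalar d1 + scalar e * var_y) * (var_x ^ 3 * var_y)))
        + standard_form 0 a 0 a1 a2 0 b1 (b2 - 3 * m * b0) d2"
      by (simp add: q standard_form_def u_def scalar_hom power2_eq_square power3_eq_cube algebra_simps)
    moreover have "var_x * q + (scalar b0 * u + (scalar d1 + scalar e * var_y) * (var_x ^ 3 * var_y)) \<in> J"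
      by (intro J_add J_mult q u x3y)
    ultimately show ?thesis unfolding P_def by blast
  qed
  have P_y: "P (var_y * p)" if p: "P p" for p
  proof -
    obtain a a1 a2 b0 b1 b2 d1 d2 e q where q: "q \<in> J" "p = q + standard_form a a1 a2 b0 b1 b2 d1 d2 e"
      using p unfolding P_def by blast
    have "var_y * p = (var_y * q + (scalar b2 * v + (scalar d2 + scalar e * var_x) * (var_x * var_y ^ 3)))
        + standard_form 0 0 a 0 a1 a2 (b0 - 3 * m * b2) b1 d1"
      by (simp add: q standard_form_def v_def scalar_hom power2_eq_square power3_eq_cube algebra_simps)
    moreover have "var_y * q + (scalar b2 * v + (scalar d2 + scalar e * var_x) * (var_x * var_y ^ 3)) \<in> J"
      by (intro J_add J_mult q v xy3)
    ultimately show ?thesis unfolding P_def by blast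
  qed
  \<comment> \<open>Closure under products follows once multiplication by each polynomial preserves \<open>P\<close>.\<close>
  have "P q \<Longrightarrow> P (p * q)" for q
  proof (induction p arbitrary: q rule: bpoly_induct)
    case (add p p')
    then show ?case by (simp add: ring_distribs P_add)
  next
    case (mult p p')
    then show ?case by (simp add: mult.assoc)
  qed (fact P_scalar P_x P_y)+
  moreover have "P 1"
  proof -
    have "1 = 0 + standard_form 1 0 0 0 0 0 0 0 0" "0 \<in> J"
      using J_mult[OF u, of 0] by (simp_all add: standard_form_def scalar_hom)
    then show ?thesis unfolding P_def by blast
  qed
  ultimately have "P (p * 1)" by blast
  then show ?thesis by (simp add: P_def J_def)
qed

lemma homogeneous_4_form:
  assumes "homogeneous 4 g"
  obtains g0 g1 g2 g3 g4 where "g = scalar g0 * var_x ^ 4 + scalar g1 * (var_x ^ 3 * var_y)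
    + scalar g2 * (var_x\<^sup>2 * var_y\<^sup>2) + scalar g3 * (var_x * var_y ^ 3) + scalar g4 * var_y ^ 4"
proof -
  have z: "coeff (coeff g j) i = 0" if "i + j \<noteq> 4" for i j
    using assms that unfolding homogeneous_def by blast
  have "g = [:[:0, 0, 0, 0, coeff (coeff g 0) 4:], [:0, 0, 0, coeff (coeff g 1) 3:],
     [:0, 0, coeff (coeff g 2) 2:], [:0, coeff (coeff g 3) 1:], [:coeff (coeff g 4) 0:]:]" (is "_ = ?h")
  proof (intro poly_eqI)
    fix i j
    show "coeff (coeff g j) i = coeff (coeff ?h j) i"
      by (auto simp: coeff_pCons numeral_eq_Suc z split: nat.splits)
  qed
  also have "\<dots> = scalar (coeff (coeff g 0) 4) * var_x ^ 4 + scalar (coeff (coeff g 1) 3) * (var_x ^ 3 * var_y)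
    + scalar (coeff (coeff g 2) 2) * (var_x\<^sup>2 * var_y\<^sup>2) + scalar (coeff (coeff g 3) 1) * (var_x * var_y ^ 3)
    + scalar (coeff (coeff g 4) 0) * var_y ^ 4"
    by (rule bpoly_eqI_value)
      (simp add: value_at_def scalar_def var_x_def var_y_def power2_eq_square power3_eq_cube power4_eq_xxxx algebra_simps)
  finally show thesis by (rule that)
qed

text \<open>
  Both partial derivatives annihilate the dual form. Conversely an operator that annihilates it has
  a standard form modulo the Jacobian ideal, and this standard form annihilates it as well, hence
  is zero.
\<close>

lemma macaulay_dual_biquadratic:
  assumes m: "9 * m\<^sup>2 \<noteq> 1"
  shows "macaulay_dual (biquadratic m) (biquadratic_mac m)"
proof -
  have "jacobian_ideal (biquadratic m) \<subseteq> annihilator (biquadratic_mac m)"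
  proof -
    have "diff_action (deriv_x (biquadratic m)) (biquadratic_mac m) = 0"
      "diff_action (deriv_y (biquadratic m)) (biquadratic_mac m) = 0"
      unfolding deriv_biquadratic biquadratic_mac_def
      by (simp_all add: power4_eq_xxxx power2_eq_square power3_eq_cube scalar_hom algebra_simps)
    then show ?thesis by (auto simp: jacobian_ideal_def annihilator_def)
  qed
  moreover have "p \<in> jacobian_ideal (biquadratic m)" if "p \<in> annihilator (biquadratic_mac m)" for p
  proof -
    obtain a a1 a2 b0 b1 b2 d1 d2 e q where q: "q \<in> jacobian_ideal (biquadratic m)"
      "p = q + standard_form a a1 a2 b0 b1 b2 d1 d2 e"
      using standard_form_exists[OF m, of p] by blast
    have "diff_action (standard_form a a1 a2 b0 b1 b2 d1 d2 e) (biquadratic_mac m) = 0"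
      using that q calculation by (auto simp: annihilator_def)
    then have z: "a = 0" "a1 = 0" "a2 = 0" "b1 = 0" "d1 = 0" "d2 = 0" "e = 0"
      and b: "12 * m * b0 - 4 * b2 = 0" "12 * m * b2 - 4 * b0 = 0"
      unfolding standard_form_action by auto
    from b have "(9 * m\<^sup>2 - 1) * b0 = 0" "(9 * m\<^sup>2 - 1) * b2 = 0" by algebra+
    then have "b0 = 0" "b2 = 0" using m by auto
    with z q show ?thesis by (simp add: standard_form_def scalar_0)
  qed
  ultimately show ?thesis
    unfolding macaulay_dual_def biquadratic_mac_def
    using biquadratic_pencil_neq_0[of m "- 2"] biquadratic_pencil_homogeneous by auto
qed

text \<open>
  Being annihilated by the two partial derivatives is a system of four linear equations for the five
  coefficients of \<open>g\<close>, and its solution space is a line because \<open>9 m^2 \<noteq> 1\<close>.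
\<close>

lemma macaulay_dual_biquadratic_unique:
  assumes m: "9 * m\<^sup>2 \<noteq> 1" and g: "macaulay_dual (biquadratic m) g"
  obtains c where "c \<noteq> 0" "g = scalar c * biquadratic_mac m"
proof -
  have J: "jacobian_ideal (biquadratic m) = annihilator g" and "homogeneous 4 g"
    using g by (simp_all add: macaulay_dual_def)
  obtain g0 g1 g2 g3 g4 where g': "g = scalar g0 * var_x ^ 4 + scalar g1 * (var_x ^ 3 * var_y)
    + scalar g2 * (var_x\<^sup>2 * var_y\<^sup>2) + scalar g3 * (var_x * var_y ^ 3) + scalar g4 * var_y ^ 4"
    using homogeneous_4_form[OF \<open>homogeneous 4 g\<close>] .
  have "deriv_x (biquadratic m) \<in> annihilator g" "deriv_y (biquadratic m) \<in> annihilator g"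
    unfolding J[symmetric] by (rule jacobian_idealI[of _ 1 _ 0], simp) (rule jacobian_idealI[of _ 0 _ 1], simp)
  then have "diff_action (deriv_x (biquadratic m)) g = 0" "diff_action (deriv_y (biquadratic m)) g = 0"
    by (simp_all add: annihilator_def)
  moreover have "diff_action (deriv_x (biquadratic m)) g =
      linear_form (vector [4 * (24 * g0 + 12 * m * g2), 4 * (6 * g1 + 18 * m * g3)])"
    "diff_action (deriv_y (biquadratic m)) g =
      linear_form (vector [4 * (6 * g3 + 18 * m * g1), 4 * (24 * g4 + 12 * m * g2)])"
    unfolding deriv_biquadratic g' linear_form_eq
    by (simp_all add: power4_eq_xxxx power2_eq_square power3_eq_cube scalar_hom algebra_simps)
  moreover have "linear_form v = 0 \<longleftrightarrow> v = 0" for v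
    using linear_form_inject[of v 0] by (simp add: linear_form_eq scalar_0)
  ultimately have e: "96 * g0 + 48 * (m * g2) = 0" "24 * g1 + 72 * (m * g3) = 0"
    "24 * g3 + 72 * (m * g1) = 0" "96 * g4 + 48 * (m * g2) = 0"
    by (simp_all add: vec_eq_iff forall_2)
  have "(9 * m\<^sup>2 - 1) * g1 = 0" "(9 * m\<^sup>2 - 1) * g3 = 0" using e(2,3) by algebra+
  then have "g1 = 0" "g3 = 0" using m by simp_all
  define h where "h = - (g2 / 2)"
  have g2: "g2 = - 2 * h" by (simp add: h_def)
  have "96 * (g0 - h * m) = 0" "96 * (g4 - h * m) = 0" using e(1,4) unfolding g2 by algebra+
  then have "g0 = h * m" "g4 = h * m" by simp_all
  with \<open>g1 = 0\<close> \<open>g3 = 0\<close> have "g = scalar h * biquadratic_mac m"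
    unfolding g' g2 biquadratic_mac_def by (intro bpoly_eqI_value) (simp add: algebra_simps)
  moreover have "g \<noteq> 0" using g by (simp add: macaulay_dual_def)
  ultimately show thesis by (intro that) auto
qed

text \<open>
  The dual form of \<open>N(m)\<close>, transported to \<open>f\<close>, shows that \<open>mac f\<close> is a dual form of \<open>f\<close>. Transporting
  \<open>mac f\<close> back gives a dual form of \<open>N(m)\<close>, which is unique up to a scalar.
\<close>

lemma proj_equiv_mac:
  assumes m: "9 * m\<^sup>2 \<noteq> 1" and f: "proj_equiv (biquadratic m) f"
  shows "proj_equiv (biquadratic_mac m) (mac f)"
proof -
  obtain d B c where B: "invertible B" "c \<noteq> 0" "f = scalar c * change_vars B (biquadratic m)"
    using f by (rule proj_equivE)
  obtain A where A: "B ** A = mat 1" "A ** B = mat 1" "\<And>p. change_vars A (change_vars B p) = p"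
    using change_vars_inverse[OF B(1)] by metis
  have "macaulay_dual f (change_vars (transpose A) (biquadratic_mac m))"
    unfolding B(3) by (rule macaulay_dual_change_vars[OF macaulay_dual_biquadratic[OF m] B(2) A(1,2)])
  then have mac: "macaulay_dual f (mac f)"
    unfolding macaulay_dual_def mac_def by (rule someI)
  have "scalar (1 / c) * change_vars A f = biquadratic m"
    using B(2) by (simp add: A B(3) flip: mult.assoc scalar_mult) (simp add: scalar_1)
  with macaulay_dual_change_vars[OF mac _ A(2,1), of "1 / c"] B(2)
  have "macaulay_dual (biquadratic m) (change_vars (transpose B) (mac f))" by simp
  then obtain e where e: "e \<noteq> 0" "change_vars (transpose B) (mac f) = scalar e * biquadratic_mac m"
    by (rule macaulay_dual_biquadratic_unique[OF m])
  have "biquadratic_mac m = scalar (1 / e) * change_vars (transpose B) (mac f)"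
    using e(1) unfolding e(2) by (simp flip: mult.assoc scalar_mult) (simp add: scalar_1)
  then have "proj_equiv (mac f) (biquadratic_mac m)"
    using mac e(1) B(1) unfolding macaulay_dual_def
    by (intro proj_equivI[of _ 4 "transpose B" "1 / e"]) (auto simp: invertible_det_nz)
  then show ?thesis by (rule proj_equiv_sym)
qed

lemma proj_equiv_hess:
  assumes "proj_equiv (biquadratic m) f"
  shows "proj_equiv (biquadratic_hess m) (hess f)"
proof -
  obtain d B c where B: "invertible B" "c \<noteq> 0" "f = scalar c * change_vars B (biquadratic m)"
    using assms by (rule proj_equivE)
  have "hess f = scalar ((c * det B)\<^sup>2 * 144) * change_vars B (biquadratic_hess m)"
    unfolding B(3) hess_change_vars hess_biquadratic by (simp add: scalar_mult mult.assoc)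
  moreover have "m \<noteq> 0 \<or> 1 - 3 * m\<^sup>2 \<noteq> 0" by auto
  moreover have "(c * det B)\<^sup>2 * 144 \<noteq> 0" using B by (simp add: invertible_det_nz)
  ultimately show ?thesis
    unfolding biquadratic_hess_def
    by (intro proj_equivI[OF biquadratic_pencil_neq_0 biquadratic_pencil_homogeneous B(1)])
qed

section \<open>Comparing the two polynomials\<close>

lemma proj_equiv_biquadratic_iff:
  assumes m: "9 * m\<^sup>2 \<noteq> 1" and n: "9 * n\<^sup>2 \<noteq> 1"
  shows "proj_equiv (biquadratic m) (biquadratic n) \<longleftrightarrow> biquadratic_j m = biquadratic_j n"
  using proj_equiv_biquadratic[OF assms] j_invariant_biquadratic[OF m]
    j_invariant_biquadratic[OF n proj_equiv_scalar[OF biquadratic_neq_0 homogeneous_biquadratic one_neq_zero]]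
  by (auto simp: scalar_1)

text \<open>
  The form \<open>biquadratic_mac m\<close> is smooth only if \<open>m\<close> and \<open>1 - m^2\<close> are nonzero. In the degenerate
  cases it is proportional to \<open>biquadratic_hess m\<close>, so that j-invariants are compared only where
  they are defined.
\<close>

lemma proj_equiv_biquadratic_mac_hess:
  assumes m: "9 * m\<^sup>2 \<noteq> 1"
  shows "proj_equiv (biquadratic_mac m) (biquadratic_hess m) \<longleftrightarrow> biquadratic_j m \<in> {0, 1728, 6912}"
proof -
  have d: "(1 - 9 * m\<^sup>2)\<^sup>2 \<noteq> 0" using m by auto
  have j1728: "biquadratic_j m = 1728 \<longleftrightarrow> m * (1 - m\<^sup>2) = 0"
  proof -
    have "(1 + 3 * m\<^sup>2) ^ 3 - (1 - 9 * m\<^sup>2)\<^sup>2 = 27 * (m * (1 - m\<^sup>2))\<^sup>2" by algebra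
    then have "(1 + 3 * m\<^sup>2) ^ 3 = (1 - 9 * m\<^sup>2)\<^sup>2 \<longleftrightarrow> m * (1 - m\<^sup>2) = 0"
      by (metis mult_eq_0_iff power_eq_0_iff right_minus_eq zero_neq_numeral zero_less_numeral)
    then show ?thesis using d by (simp add: biquadratic_j_def nonzero_divide_eq_eq del: power_eq_0_iff)
  qed
  have refl: "proj_equiv (biquadratic_mac m) (scalar c * biquadratic_mac m)" if "c \<noteq> 0" for c
    unfolding biquadratic_mac_def
    using biquadratic_pencil_neq_0[of m "- 2"] biquadratic_pencil_homogeneous that by (intro proj_equiv_scalar) auto
  consider "m = 0" | "m \<noteq> 0" "m\<^sup>2 = 1" | "m \<noteq> 0" "m\<^sup>2 \<noteq> 1" by blast
  then show ?thesis
  proof cases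
    case 1
    have "biquadratic_hess m = scalar (- 1 / 2) * biquadratic_mac m"
      by (simp add: 1 biquadratic_hess_def biquadratic_mac_def scalar_0 flip: mult.assoc scalar_mult)
    then show ?thesis using refl[of "- 1 / 2"] j1728 1 by auto
  next
    case 2
    then have "biquadratic_hess m = scalar 1 * biquadratic_mac m"
      by (simp add: biquadratic_hess_def biquadratic_mac_def scalar_1)
    then show ?thesis using refl[of 1] j1728 2 by auto
  next
    case 3
    define n k where "n = - 1 / (3 * m)" and "k = (1 - 3 * m\<^sup>2) / (6 * m)"
    have nm: "3 * (m * n) = - 1" and km: "6 * (m * k) = 1 - 3 * m\<^sup>2" using 3 by (simp_all add: n_def k_def)
    have G: "biquadratic_mac m = scalar m * biquadratic n"
    proof -
      have "6 * (m * n) = - 2" using nm by algebra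
      then show ?thesis
        by (intro bpoly_eqI_value) (simp add: biquadratic_mac_def, algebra)
    qed
    have H: "biquadratic_hess m = scalar m * biquadratic k"
    proof -
      show ?thesis
        using km by (intro bpoly_eqI_value) (simp add: biquadratic_hess_def, algebra)
    qed
    have n2: "9 * m\<^sup>2 * n\<^sup>2 = 1" and k2: "36 * m\<^sup>2 * k\<^sup>2 = (1 - 3 * m\<^sup>2)\<^sup>2" using nm km by algebra+
    have m1: "1 - m\<^sup>2 \<noteq> 0" "1 - 9 * m\<^sup>2 \<noteq> 0" using 3 m by auto
    have nn: "m\<^sup>2 * (1 - 9 * n\<^sup>2) = - (1 - m\<^sup>2)" using n2 by algebra
    have kk: "4 * m\<^sup>2 * (1 - 9 * k\<^sup>2) = - ((1 - m\<^sup>2) * (1 - 9 * m\<^sup>2))" using k2 by algebra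
    have n1: "1 - 9 * n\<^sup>2 \<noteq> 0" and k1: "1 - 9 * k\<^sup>2 \<noteq> 0" using nn kk m1 by auto
    have nn': "3 * m\<^sup>2 * (1 + 3 * n\<^sup>2) = 1 + 3 * m\<^sup>2" using n2 by algebra
    have kk': "12 * m\<^sup>2 * (1 + 3 * k\<^sup>2) = (1 + 3 * m\<^sup>2)\<^sup>2" using k2 by algebra
    define N where "N = 1 + 3 * m\<^sup>2"
    have jn: "biquadratic_j n = 64 * N ^ 3 / (m\<^sup>2 * (1 - m\<^sup>2)\<^sup>2)"
    proof -
      have e: "1 + 3 * n\<^sup>2 = N / (3 * m\<^sup>2)" "1 - 9 * n\<^sup>2 = - (1 - m\<^sup>2) / m\<^sup>2"
        using nn nn' 3 by (simp_all add: N_def field_simps)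
      have simplify: "1728 * (x / (3 * y)) ^ 3 / (- z / y)\<^sup>2 = 64 * x ^ 3 / (y * z\<^sup>2)"
        if "y \<noteq> 0" "z \<noteq> 0" for x y z :: complex
        using that by (simp add: field_simps power2_eq_square power3_eq_cube)
      show ?thesis unfolding biquadratic_j_def e by (rule simplify) (use 3(1) m1 in simp_all)
    qed
    have jk: "biquadratic_j k = 16 * N ^ 6 / (m\<^sup>2 * (1 - m\<^sup>2)\<^sup>2 * (1 - 9 * m\<^sup>2)\<^sup>2)"
    proof -
      have e: "1 + 3 * k\<^sup>2 = N\<^sup>2 / (12 * m\<^sup>2)" "1 - 9 * k\<^sup>2 = - ((1 - m\<^sup>2) * (1 - 9 * m\<^sup>2)) / (4 * m\<^sup>2)"
        using kk kk' 3 by (simp_all add: N_def field_simps)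
      have simplify: "1728 * (x\<^sup>2 / (12 * y)) ^ 3 / (- (z * w) / (4 * y))\<^sup>2 = 16 * x ^ 6 / (y * z\<^sup>2 * w\<^sup>2)"
        if "y \<noteq> 0" "z \<noteq> 0" "w \<noteq> 0" for x y z w :: complex
        using that by (simp add: field_simps power2_eq_square power3_eq_cube eval_nat_numeral)
      show ?thesis unfolding biquadratic_j_def e by (rule simplify) (use 3(1) m1 in simp_all)
    qed
    have cross: "a / d = b / (d * e) \<longleftrightarrow> a * e = b" if "d \<noteq> 0" "e \<noteq> 0" for a b d e :: complex
      using that by (simp add: field_simps)
    have "biquadratic_j n = biquadratic_j k \<longleftrightarrow> 64 * N ^ 3 * (1 - 9 * m\<^sup>2)\<^sup>2 = 16 * N ^ 6"
      unfolding jn jk by (intro cross) (use 3(1) m1 in simp_all)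
    also have "\<dots> \<longleftrightarrow> N ^ 3 = 0 \<or> N ^ 3 = 4 * (1 - 9 * m\<^sup>2)\<^sup>2"
    proof -
      have "64 * u * w = 16 * (u * u) \<longleftrightarrow> u = 0 \<or> u = 4 * w" for u w :: complex
        by (cases "u = 0") auto
      moreover have "N ^ 6 = N ^ 3 * N ^ 3" by (simp flip: power_add)
      ultimately show ?thesis by (simp only:)
    qed
    also have "\<dots> \<longleftrightarrow> biquadratic_j m \<in> {0, 6912}"
    proof -
      have r: "1728 * u / w = 0 \<longleftrightarrow> u = 0" "1728 * u / w = 6912 \<longleftrightarrow> u = 4 * w" if "w \<noteq> 0" for u w :: complex
        using that by (auto simp: divide_eq_eq)
      show ?thesis
        unfolding biquadratic_j_def N_def insert_iff empty_iff r(1)[OF d] r(2)[OF d] by simp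
    qed
    also have "\<dots> \<longleftrightarrow> biquadratic_j m \<in> {0, 1728, 6912}" using j1728 3 by auto
    finally have j: "biquadratic_j n = biquadratic_j k \<longleftrightarrow> biquadratic_j m \<in> {0, 1728, 6912}" .
    have sc: "proj_equiv (biquadratic l) (scalar m * biquadratic l)" for l
      by (rule proj_equiv_scalar[OF biquadratic_neq_0 homogeneous_biquadratic 3(1)])
    have "proj_equiv (biquadratic_mac m) (biquadratic_hess m) \<longleftrightarrow> proj_equiv (biquadratic n) (biquadratic k)"
      unfolding G H using proj_equiv_congr[OF sc sc] .
    then show ?thesis using j proj_equiv_biquadratic_iff[of n k] n1 k1 by auto
  qed
qed

lemma mac_hess_iff_j_invariant:
  assumes "smooth_quartic f"
  shows "proj_equiv (mac f) (hess f) \<longleftrightarrow> j_invariant f \<in> {0, 1728, 6912}"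
proof -
  obtain m where m: "9 * m\<^sup>2 \<noteq> 1" "proj_equiv (biquadratic m) f"
    using smooth_quartic_normal_form[OF assms] .
  have "proj_equiv (mac f) (hess f) \<longleftrightarrow> proj_equiv (biquadratic_mac m) (biquadratic_hess m)"
    using proj_equiv_congr[OF proj_equiv_mac[OF m] proj_equiv_hess[OF m(2)]] by blast
  then show ?thesis
    by (simp only: proj_equiv_biquadratic_mac_hess[OF m(1)] j_invariant_biquadratic[OF m])
qed

lemma proj_equiv_iff_j_invariant:
  assumes "smooth_quartic f" "smooth_quartic h"
  shows "proj_equiv f h \<longleftrightarrow> j_invariant f = j_invariant h"
proof -
  obtain m where m: "9 * m\<^sup>2 \<noteq> 1" "proj_equiv (biquadratic m) f"
    using smooth_quartic_normal_form[OF assms(1)] .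
  obtain n where n: "9 * n\<^sup>2 \<noteq> 1" "proj_equiv (biquadratic n) h"
    using smooth_quartic_normal_form[OF assms(2)] .
  have "proj_equiv f h \<longleftrightarrow> proj_equiv (biquadratic m) (biquadratic n)"
    using proj_equiv_congr[OF m(2) n(2)] by blast
  then show ?thesis
    by (simp add: proj_equiv_biquadratic_iff[OF m(1) n(1)] j_invariant_biquadratic[OF m] j_invariant_biquadratic[OF n])
qed

section \<open>The three classes\<close>

text \<open>
  For given \<open>z\<close>, \<open>j = z\<close> is a cubic equation for \<open>s = m^2\<close>. It has no root with \<open>9 s = 1\<close>, as there
  the denominator of \<open>j\<close> vanishes but its numerator does not.
\<close>

lemma j_invariant_surj: "\<exists>f. smooth_quartic f \<and> j_invariant f = z"
proof -
  obtain s where s: "1728 * (1 + 3 * s) ^ 3 = z * (1 - 9 * s)\<^sup>2"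
  proof -
    let ?p = "smult 1728 ([:1, 3:] ^ 3) - smult z ([:1, - 9:] ^ 2)"
    have "coeff ?p 3 \<noteq> 0" by (simp add: power3_eq_cube power2_eq_square numeral_eq_Suc)
    then have "degree ?p \<noteq> 0" by (metis coeff_eq_0 gr0I zero_less_numeral)
    then have "\<not> constant (poly ?p)" by (simp add: constant_degree)
    then obtain s where "poly ?p s = 0" using fundamental_theorem_of_algebra by blast
    then show thesis by (intro that[of s]) (simp add: mult.commute)
  qed
  define m where "m = csqrt s"
  have m: "m\<^sup>2 = s" by (simp add: m_def)
  have "9 * m\<^sup>2 \<noteq> 1"
  proof
    assume "9 * m\<^sup>2 = 1"
    then have "1 - 9 * s = 0" "3 * (1 + 3 * s) = 4" unfolding m by (simp, algebra)
    moreover from this(1) have "1 + 3 * s = 0" using s by simp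
    ultimately show False by simp
  qed
  moreover from this have "biquadratic_j m = z"
    using s by (simp add: biquadratic_j_def m divide_eq_eq)
  moreover have "proj_equiv (biquadratic m) (biquadratic m)"
    using proj_equiv_scalar[OF biquadratic_neq_0 homogeneous_biquadratic one_neq_zero, of m] by (simp add: scalar_1)
  ultimately show ?thesis
    using smooth_quartic_biquadratic j_invariant_biquadratic by blast
qed

theorem proposition4p1:
  shows "card mac_hess_classes = 3 \<and>
    bij_betw (\<lambda>C. j_invariant ` C) mac_hess_classes {{0}, {1728}, {6912}} \<and>
    (\<forall>f. smooth_quartic f \<longrightarrow>
       (proj_equiv (mac f) (hess f) \<longleftrightarrow> j_invariant f \<in> {0, 1728, 6912}))"
proof -
  let ?Z = "{0, 1728, 6912} :: complex set"
  \<comment> \<open>As \<open>j\<close> is a complete invariant, the equivalence classes are its fibres.\<close>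
  define fibre where "fibre z = {f. smooth_quartic f \<and> j_invariant f = z}" for z
  have ne: "\<exists>f. f \<in> fibre z" for z using j_invariant_surj by (simp add: fibre_def)
  have "{(p, q). smooth_quartic p \<and> smooth_quartic q \<and> proj_equiv p q} `` {f} = fibre (j_invariant f)"
    if "smooth_quartic f" for f
    using that proj_equiv_iff_j_invariant[OF that] unfolding fibre_def by auto
  then have "smooth_quartic_classes = (\<lambda>f. fibre (j_invariant f)) ` {f. smooth_quartic f}"
    unfolding smooth_quartic_classes_def quotient_def by (auto simp: image_iff)
  also have "\<dots> = fibre ` j_invariant ` {f. smooth_quartic f}" by (simp only: image_image)
  also have "j_invariant ` {f. smooth_quartic f} = UNIV"
    using j_invariant_surj by (auto simp: image_iff) metis
  finally have "smooth_quartic_classes = range fibre" .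
  moreover have "(\<exists>f\<in>fibre z. proj_equiv (mac f) (hess f)) \<longleftrightarrow> z \<in> ?Z" for z
  proof -
    have "proj_equiv (mac f) (hess f) \<longleftrightarrow> z \<in> ?Z" if "f \<in> fibre z" for f
      using that mac_hess_iff_j_invariant[of f] unfolding fibre_def by blast
    then show ?thesis using ne by blast
  qed
  ultimately have classes: "mac_hess_classes = fibre ` ?Z"
    unfolding mac_hess_classes_def by blast
  have image: "j_invariant ` fibre z = {z}" for z
    using ne[of z] by (auto simp: fibre_def)
  have "bij_betw (\<lambda>C. j_invariant ` C) mac_hess_classes {{0}, {1728}, {6912}}"
    unfolding bij_betw_def classes by (simp add: image inj_on_def)
  moreover from this have "card mac_hess_classes = card {{0}, {1728}, {6912 :: complex}}"
    by (rule bij_betw_same_card)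
  ultimately show ?thesis using mac_hess_iff_j_invariant by simp
qed

end
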